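(* Let $L$ be a finite geometric ranked meet semi-lattice with $n$ atoms and $k$ a field of characteristic $2$. Let $\Delta(L)=\Delta_B(L)$ for a generic basis $B$ of $V$ (notation in the context). Then $\Delta(L)$ is a shifted simplicial complex on $\{1,\dots,n\}$ with $f(\Delta(L))=f(L)$, and $\Delta(L)$ does not depend on the chosen total order of the atoms, on the choice of the generic basis $B$, or on the choice of the characteristic $2$ field $k$.
   Context: A ranked meet semi-lattice has minimum $\hat 0$, rank function $r$ with $r(\hat0)=0$ and $r(y)=r(x)+1$ whenever $y$ covers $x$; atomic means every element is a join of atoms; a ranked atomic meet semi-lattice is geometric if $r(x\wedge y)+r(x\vee y)\le r(x)+r(y)$ whenever $x\vee y$ exists. Let $L_1$ be the set of atoms, $\hat L=L\cup\{\hat 1\}$ with $\hat 1$ a new maximum, joins of sets of atoms taken in $\hat L$. Let $V$ have basis $\{e_u:u\in L_1\}$, fix a total order on $L_1$, and for $S\subseteq L_1$ let $e_S$ be the wedge product of the $e_s$, $s\in S$, in increasing order. Let $I_L$ be the ideal of $\bigwedge V$ generated by: $e_S$ with $\vee S=\hat 1$; $e_S$ with $\vee S\in L$, $r(\vee S)\ne|S|$; $e_S-e_T$ with $S\ne T$, $\vee S=\vee T\in L$, $r(\vee S)=|S|=|T|$. Let $\bigwedge L=\bigwedge V/I_L$ and write $\tilde w$ for the image of $w$. For an ordered basis $B=(b_1,\dots,b_n)$ of $V$ and $S\subseteq\{1,\dots,n\}$ let $b_S$ be the wedge product of the $b_s$, $s\in S$, in increasing order. Lexicographic order on equal-size sets: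 $S<_L T$ iff $\min(S\triangle T)\in S$. Define $\Delta_B(L)=\{S\subseteq\{1,\dots,n\}: \tilde b_S\notin\mathrm{span}_k\{\tilde b_T:|T|=|S|,\ T<_L S\}\}$. $B$ is generic if the entries of the transition matrix from $\{e_u\}$ to $B$ are algebraically independent over a subfield of $k$ (alternatively, extend $k$ by $n^2$ indeterminates and take them as the transition matrix entries). A family $A$ of finite subsets of $\mathbb N$ is shifted if $S\in A$ and $T=\{t_1<\dots<t_j\}$, $S=\{s_1<\dots<s_j\}$ with $t_i\le s_i$ for all $i$ imply $T\in A$. The $f$-vector of a simplicial complex counts in $f_i$ the faces of size $i+1$ ($f_{-1}=1$); that of $L$ counts in $f_i$ the elements of rank $i+1$. *)

theory Defs
  imports
    Complex_Main
    "HOL-Library.Lub_Glb"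
    "HOL-Library.Lattice_Constructions"
    "HOL-Library.Function_Algebras"
    "HOL-Library.Poly_Mapping"
begin

section \<open>Geometric ranked meet semi-lattices\<close>

definition covers :: "'a::order \<Rightarrow> 'a \<Rightarrow> bool"
  where "covers x y \<longleftrightarrow> x < y \<and> \<not> (\<exists>z. x < z \<and> z < y)"

definition rank_function :: "('a::order_bot \<Rightarrow> nat) \<Rightarrow> bool"
  where "rank_function r \<longleftrightarrow> r bot = 0 \<and> (\<forall>x y. covers x y \<longrightarrow> r y = r x + 1)"

definition atoms :: "'a::order_bot set"
  where "atoms = {u. covers bot u}"

definition atomic_semilattice :: "'a::order_bot itself \<Rightarrow> bool"
  where "atomic_semilattice _ \<longleftrightarrow> (\<forall>x::'a. \<exists>S\<subseteq>atoms. isLub UNIV S x)"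

definition geometric_semilattice :: "('a::{semilattice_inf,order_bot} \<Rightarrow> nat) \<Rightarrow> bool"
  where "geometric_semilattice r \<longleftrightarrow>
    rank_function r \<and> atomic_semilattice TYPE('a) \<and>
    (\<forall>x y z. isLub UNIV {x, y} z \<longrightarrow> r (inf x y) + r z \<le> r x + r y)"

text \<open>The type \<^typ>\<open>'a top\<close> is the poset with a new maximum \<open>top.Top\<close> adjoined; old elements are
  embedded by \<open>top.Value\<close>. If the poset is a finite meet semi-lattice, all joins exist in it.\<close>

definition hat_join :: "'a::order set \<Rightarrow> 'a top"
  where "hat_join S = (THE x. isLub UNIV (top.Value ` S) x)"

section \<open>The exterior algebra on a basis indexed by a set\<close>

definition fscale :: "'k::field \<Rightarrow> ('i \<Rightarrow> 'k) \<Rightarrow> 'i \<Rightarrow> 'k"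
  where "fscale c f = (\<lambda>i. c * f i)"

global_interpretation fun_vs: vector_space "fscale :: 'k::field \<Rightarrow> ('i \<Rightarrow> 'k) \<Rightarrow> 'i \<Rightarrow> 'k"
  by standard (simp_all add: fscale_def fun_eq_iff algebra_simps)

text \<open>A vector of the space \<open>V\<close> with basis \<open>{e\<^sub>u : u \<in> A}\<close> is its coordinate function
  \<open>u \<mapsto> v u\<close>. An element of \<open>\<Lambda>V\<close> is its coordinate function \<open>S \<mapsto> w S\<close> with respect to the
  standard basis \<open>{e\<^sub>S : S \<subseteq> A}\<close>, where \<open>A\<close> is finite and totally ordered by the relation \<open>ord\<close>.
  The product is the bilinear one with \<open>e\<^sub>S \<and> e\<^sub>T = 0\<close> if \<open>S\<close> and \<open>T\<close> meet, and
  \<open>e\<^sub>S \<and> e\<^sub>T = (-1)\<^sup>i e\<^bsub>S \<union> T\<^esub>\<close> otherwise, \<open>i\<close> being the number of inversions.\<close>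

definition vec_space :: "'a set \<Rightarrow> ('a \<Rightarrow> 'k::field) set"
  where "vec_space A = {v. \<forall>u. v u \<noteq> 0 \<longrightarrow> u \<in> A}"

definition ext_space :: "'a set \<Rightarrow> ('a set \<Rightarrow> 'k::field) set"
  where "ext_space A = {w. \<forall>S. w S \<noteq> 0 \<longrightarrow> S \<subseteq> A}"

definition inversions :: "'a rel \<Rightarrow> 'a set \<Rightarrow> 'a set \<Rightarrow> nat"
  where "inversions ord S T = card {(s, t). s \<in> S \<and> t \<in> T \<and> (t, s) \<in> ord}"

definition wedge :: "'a rel \<Rightarrow> ('a set \<Rightarrow> 'k::field) \<Rightarrow> ('a set \<Rightarrow> 'k) \<Rightarrow> 'a set \<Rightarrow> 'k"
  where "wedge ord v w =
    (\<lambda>U. \<Sum>S\<in>Pow U. (- 1) ^ inversions ord S (U - S) * v S * w (U - S))"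

definition ext_one :: "'a set \<Rightarrow> 'k::field"
  where "ext_one = (\<lambda>S. if S = {} then 1 else 0)"

definition ext_vec :: "('a \<Rightarrow> 'k::field) \<Rightarrow> 'a set \<Rightarrow> 'k"
  where "ext_vec v = (\<lambda>S. if is_singleton S then v (the_elem S) else 0)"

definition wedge_list :: "'a rel \<Rightarrow> ('a \<Rightarrow> 'k::field) list \<Rightarrow> 'a set \<Rightarrow> 'k"
  where "wedge_list ord vs = foldr (\<lambda>v w. wedge ord (ext_vec v) w) vs ext_one"

definition unit_vec :: "'a \<Rightarrow> 'a \<Rightarrow> 'k::field"
  where "unit_vec u = (\<lambda>x. if x = u then 1 else 0)"

definition increasing_list :: "'a rel \<Rightarrow> 'a set \<Rightarrow> 'a list"
  where "increasing_list ord S =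
    (THE xs. distinct xs \<and> set xs = S \<and> sorted_wrt (\<lambda>x y. (x, y) \<in> ord) xs)"

definition e_wedge :: "'a rel \<Rightarrow> 'a set \<Rightarrow> 'a set \<Rightarrow> 'k::field"
  where "e_wedge ord S = wedge_list ord (map unit_vec (increasing_list ord S))"

definition b_wedge :: "'a rel \<Rightarrow> (nat \<Rightarrow> 'a \<Rightarrow> 'k::field) \<Rightarrow> nat set \<Rightarrow> 'a set \<Rightarrow> 'k"
  where "b_wedge ord b S = wedge_list ord (map b (sorted_list_of_set S))"

definition ext_ideal :: "'a rel \<Rightarrow> 'a set \<Rightarrow> ('a set \<Rightarrow> 'k::field) set \<Rightarrow> bool"
  where "ext_ideal ord A I \<longleftrightarrow>
    I \<subseteq> ext_space A \<and> 0 \<in> I \<and> (\<forall>v\<in>I. \<forall>w\<in>I. v + w \<in> I) \<and>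
    (\<forall>v\<in>I. \<forall>w\<in>ext_space A. wedge ord v w \<in> I \<and> wedge ord w v \<in> I)"

section \<open>The algebra of a semi-lattice\<close>

definition L_generators ::
    "('a::{semilattice_inf,order_bot} \<Rightarrow> nat) \<Rightarrow> 'a rel \<Rightarrow> ('a set \<Rightarrow> 'k::field) set"
  where "L_generators r ord =
    {e_wedge ord S | S. S \<subseteq> atoms \<and> hat_join S = top.Top} \<union>
    {e_wedge ord S | S x. S \<subseteq> atoms \<and> hat_join S = top.Value x \<and> r x \<noteq> card S} \<union>
    {e_wedge ord S - e_wedge ord T | S T x. S \<subseteq> atoms \<and> T \<subseteq> atoms \<and> S \<noteq> T \<and>
       hat_join S = top.Value x \<and> hat_join T = top.Value x \<and> r x = card S \<and> r x = card T}"

definition L_ideal ::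
    "('a::{semilattice_inf,order_bot} \<Rightarrow> nat) \<Rightarrow> 'a rel \<Rightarrow> ('a set \<Rightarrow> 'k::field) set"
  where "L_ideal r ord = ext_ideal ord atoms hull L_generators r ord"

text \<open>The projection of \<open>\<Lambda>V\<close> onto the quotient \<open>\<Lambda>L\<close>, whose elements are cosets of the ideal.\<close>

definition L_proj ::
    "('a::{semilattice_inf,order_bot} \<Rightarrow> nat) \<Rightarrow> 'a rel \<Rightarrow> ('a set \<Rightarrow> 'k::field) \<Rightarrow>
      ('a set \<Rightarrow> 'k) set"
  where "L_proj r ord w = {v \<in> ext_space atoms. v - w \<in> L_ideal r ord}"

definition lex_less :: "nat set \<Rightarrow> nat set \<Rightarrow> bool"
  where "lex_less S T \<longleftrightarrow> S \<noteq> T \<and> Min ((S - T) \<union> (T - S)) \<in> S"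

text \<open>The vector space structure of \<open>\<Lambda>L\<close> is the one that makes the projection linear, so the
  span of a set of images is the image of the span.\<close>

definition Delta ::
    "('a::{semilattice_inf,order_bot} \<Rightarrow> nat) \<Rightarrow> 'a rel \<Rightarrow> (nat \<Rightarrow> 'a \<Rightarrow> 'k::field) \<Rightarrow> nat set set"
  where "Delta r ord b =
    {S. S \<subseteq> {1..card (atoms :: 'a set)} \<and>
      L_proj r ord (b_wedge ord b S) \<notin>
        L_proj r ord ` fun_vs.span {b_wedge ord b T | T.
          T \<subseteq> {1..card (atoms :: 'a set)} \<and> card T = card S \<and> lex_less T S}}"

section \<open>Generic bases\<close>

definition is_subfield :: "'k::field set \<Rightarrow> bool"
  where "is_subfield F \<longleftrightarrow> 0 \<in> F \<and> 1 \<in> F \<and>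
    (\<forall>x\<in>F. \<forall>y\<in>F. x + y \<in> F \<and> x * y \<in> F) \<and> (\<forall>x\<in>F. - x \<in> F \<and> inverse x \<in> F)"

text \<open>A polynomial in variables indexed by \<open>'i\<close> is a finitely supported function from monomials
  to coefficients, and a monomial is a finitely supported function from variables to exponents.\<close>

definition mpoly_eval :: "('i \<Rightarrow> 'k::field) \<Rightarrow> (('i \<Rightarrow>\<^sub>0 nat) \<Rightarrow>\<^sub>0 'k) \<Rightarrow> 'k"
  where "mpoly_eval x p =
    (\<Sum>m\<in>Poly_Mapping.keys p. Poly_Mapping.lookup p m *
      (\<Prod>i\<in>Poly_Mapping.keys m. x i ^ Poly_Mapping.lookup m i))"

definition alg_indep_over :: "'k::field set \<Rightarrow> 'i set \<Rightarrow> ('i \<Rightarrow> 'k) \<Rightarrow> bool"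
  where "alg_indep_over F I x \<longleftrightarrow>
    (\<forall>p. (\<forall>m. Poly_Mapping.lookup p m \<in> F) \<and>
         (\<forall>m\<in>Poly_Mapping.keys p. Poly_Mapping.keys m \<subseteq> I) \<and>
         mpoly_eval x p = 0 \<longrightarrow> p = 0)"

definition ordered_basis :: "'a set \<Rightarrow> (nat \<Rightarrow> 'a \<Rightarrow> 'k::field) \<Rightarrow> bool"
  where "ordered_basis A b \<longleftrightarrow>
    inj_on b {1..card A} \<and> fun_vs.independent (b ` {1..card A}) \<and>
    fun_vs.span (b ` {1..card A}) = vec_space A"

text \<open>The entries of the transition matrix are the coordinates \<open>b j u\<close>. Taking these entries to be
  indeterminates over a field \<open>k\<close> is the case where the scalars are \<open>k(x\<^sub>u\<^sub>j)\<close> and the subfield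
  is \<open>k\<close>.\<close>

definition generic_basis :: "'a set \<Rightarrow> (nat \<Rightarrow> 'a \<Rightarrow> 'k::field) \<Rightarrow> bool"
  where "generic_basis A b \<longleftrightarrow> ordered_basis A b \<and>
    (\<exists>F. is_subfield F \<and> alg_indep_over F (A \<times> {1..card A}) (\<lambda>(u, j). b j u))"

section \<open>Simplicial complexes, shiftedness and \<open>f\<close>-vectors\<close>

definition simplicial_complex_on :: "nat set \<Rightarrow> nat set set \<Rightarrow> bool"
  where "simplicial_complex_on X K \<longleftrightarrow>
    {} \<in> K \<and> (\<forall>S\<in>K. S \<subseteq> X) \<and> (\<forall>S\<in>K. \<forall>T\<subseteq>S. T \<in> K)"

text \<open>The natural numbers start at \<open>1\<close> here, as the ground set is \<open>{1..n}\<close>.\<close>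

definition shifted :: "nat set set \<Rightarrow> bool"
  where "shifted K \<longleftrightarrow>
    (\<forall>S\<in>K. finite S \<and> S \<subseteq> {1..}) \<and>
    (\<forall>S\<in>K. \<forall>T. finite T \<and> T \<subseteq> {1..} \<and>
       list_all2 (\<le>) (sorted_list_of_set T) (sorted_list_of_set S) \<longrightarrow> T \<in> K)"

definition f_complex :: "nat set set \<Rightarrow> int \<Rightarrow> nat"
  where "f_complex K i = card {S \<in> K. int (card S) = i + 1}"

definition f_semilattice :: "('a \<Rightarrow> nat) \<Rightarrow> int \<Rightarrow> nat"
  where "f_semilattice r i = card {x. int (r x) = i + 1}"

end

theory Submission
  imports Defs "HOL-Combinatorics.Transposition"
begin

text \<open>In characteristic 2 the exterior product has no signs, so the total order of the atoms plays
  no role. Call \<open>S\<close> a basis of \<open>x \<in> L\<close> if \<open>S\<close> is a set of \<open>r x\<close> atoms with join \<open>x\<close>. By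
  submodularity the independent sets behave as in a matroid, and the ideal \<open>I\<^sub>L\<close> is the
  kernel of the map \<open>\<phi>\<close> that sends \<open>e\<^sub>S\<close> to \<open>x\<close> if \<open>S\<close> is a basis of \<open>x\<close>, and to \<open>0\<close> if \<open>S\<close> is not a
  basis. Hence the rank \<open>d\<close> part of the quotient has the elements of rank \<open>d\<close> as a basis, and the
  lexicographically greedy basis picked from the \<open>b\<^sub>S\<close> with \<open>|S| = d\<close> has equally many members.
  Multiplication by \<open>b\<^sub>j\<close> shows that the family is closed under subsets. Whether a vector
  lies in a span is decided by Gaussian elimination, which depends only on which
  integer polynomials vanish at the matrix entries; for generic entries these are the polynomials
  with even coefficients. So the family does not depend on the field or on the basis, and
  exchanging \<open>b\<^sub>i\<close> and \<open>b\<^sub>j\<close> gives shiftedness.\<close>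

section \<open>Joins and ranks\<close>

lemma isLub_UNIV_iff: "isLub UNIV S x \<longleftrightarrow> (\<forall>s\<in>S. s \<le> x) \<and> (\<forall>y. (\<forall>s\<in>S. s \<le> y) \<longrightarrow> x \<le> y)"
  by (auto simp: isLub_def leastP_def isUb_def setle_def setge_def)

lemma isLub_UNIV_unique: "isLub UNIV S x \<Longrightarrow> isLub UNIV S y \<Longrightarrow> x = (y :: 'a::order)"
  by (auto simp: isLub_UNIV_iff intro!: antisym)

lemma finite_has_glb:
  fixes U :: "'a::semilattice_inf set"
  assumes "finite U" "U \<noteq> {}"
  shows "\<exists>g. (\<forall>u\<in>U. g \<le> u) \<and> (\<forall>y. (\<forall>u\<in>U. y \<le> u) \<longrightarrow> y \<le> g)"
  using assms
proof (induction U rule: finite_ne_induct)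
  case (singleton x)
  then show ?case by auto
next
  case (insert x F)
  then obtain g where g: "\<forall>u\<in>F. g \<le> u" "\<forall>y. (\<forall>u\<in>F. y \<le> u) \<longrightarrow> y \<le> g" by blast
  show ?case
    by (rule exI[of _ "inf x g"]) (use g in \<open>auto intro: le_infI2\<close>)
qed

text \<open>The set of upper bounds is finite and contains \<open>z\<close>, so it has a meet, and
  this meet is the least upper bound.\<close>

lemma bounded_has_lub:
  fixes z :: "'a::{finite,semilattice_inf}"
  assumes "\<forall>s\<in>S. s \<le> z"
  shows "\<exists>x. isLub UNIV S x \<and> x \<le> z"
proof -
  obtain g where "\<forall>u\<in>{y. \<forall>s\<in>S. s \<le> y}. g \<le> u"
      "\<forall>y. (\<forall>u\<in>{y. \<forall>s\<in>S. s \<le> y}. y \<le> u) \<longrightarrow> y \<le> g"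
    using finite_has_glb[of "{y. \<forall>s\<in>S. s \<le> y}"] assms by auto
  then show ?thesis
    using assms by (intro exI[of _ g]) (auto simp: isLub_UNIV_iff)
qed

text \<open>A join that exists in the semi-lattice remains the join after a top is added. If there
  is none, then by \<open>bounded_has_lub\<close> the set has no upper bound at all, and the new top
  is its only bound. Either way the description in \<open>hat_join\<close> denotes the actual
  join.\<close>

lemma hat_join_eq_Value_iff:
  fixes S :: "'a::{finite,semilattice_inf} set"
  shows "hat_join S = top.Value x \<longleftrightarrow> isLub UNIV S x"
proof -
  have val: "isLub UNIV (top.Value ` S) (top.Value y)" if "isLub UNIV S y" for y
    unfolding isLub_UNIV_iff
  proof (intro conjI allI impI)
    fix z :: "'a top"
    show "\<forall>s\<in>top.Value ` S. s \<le> z \<Longrightarrow> top.Value y \<le> z"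
      using that by (cases z) (auto simp: isLub_UNIV_iff)
  qed (use that in \<open>auto simp: isLub_UNIV_iff\<close>)
  have hj: "hat_join S = y" if "isLub UNIV (top.Value ` S) y" for y
    unfolding hat_join_def using that by (blast intro: isLub_UNIV_unique)
  show ?thesis
  proof
    assume eq: "hat_join S = top.Value x"
    show "isLub UNIV S x"
    proof (cases "\<exists>y. isLub UNIV S y")
      case True
      then show ?thesis using val hj eq by (metis top.inject)
    next
      case False
      then have nb: "\<not> (\<forall>s\<in>S. s \<le> z)" for z using bounded_has_lub by blast
      have "isLub UNIV (top.Value ` S) top.Top"
        unfolding isLub_UNIV_iff
      proof (intro conjI allI impI)
        fix z :: "'a top"
        show "\<forall>s\<in>top.Value ` S. s \<le> z \<Longrightarrow> top.Top \<le> z"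
          using nb by (cases z) auto
      qed auto
      then show ?thesis using hj[of top.Top] eq by simp
    qed
  qed (use val hj in blast)
qed

lemma hat_join_eq_Top_iff:
  fixes S :: "'a::{finite,semilattice_inf} set"
  shows "hat_join S = top.Top \<longleftrightarrow> (\<forall>x. \<not> isLub UNIV S x)"
  by (cases "hat_join S") (auto simp flip: hat_join_eq_Value_iff)

section \<open>Matroid-like behaviour of the bases of an element\<close>

definition bases :: "('a::order_bot \<Rightarrow> nat) \<Rightarrow> 'a \<Rightarrow> 'a set set"
  where "bases r x = {S. S \<subseteq> atoms \<and> isLub UNIV S x \<and> card S = r x}"

lemma bases_unique: "S \<in> bases r x \<Longrightarrow> S \<in> bases r y \<Longrightarrow> x = y"
  by (auto simp: bases_def intro: isLub_UNIV_unique)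

locale geometric_lattice =
  fixes r :: "'a::{finite,semilattice_inf,order_bot} \<Rightarrow> nat"
  assumes geometric: "geometric_semilattice r"
begin

lemma rank_bot: "r bot = 0"
  and rank_covers: "covers x y \<Longrightarrow> r y = r x + 1"
  and atomic: "\<exists>S\<subseteq>atoms. isLub UNIV S (x :: 'a)"
  and submodular: "isLub UNIV {x, y} z \<Longrightarrow> r (inf x y) + r z \<le> r x + r y"
  using geometric
  unfolding geometric_semilattice_def rank_function_def atomic_semilattice_def by auto

lemma rank_atom: "u \<in> atoms \<Longrightarrow> r u = 1"
  using rank_covers[of bot u] by (simp add: atoms_def rank_bot)

text \<open>Induction on the number of elements strictly between \<open>x\<close> and
  \<open>y\<close>: either \<open>y\<close> covers \<open>x\<close>, or an intermediate
  \<open>z\<close> splits the interval into two with fewer inner elements.\<close>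

lemma rank_strict_mono: "x < y \<Longrightarrow> r x < r y"
proof (induction "card {z. x < z \<and> z < y}" arbitrary: x y rule: less_induct)
  case less
  show ?case
  proof (cases "covers x y")
    case True
    then show ?thesis using rank_covers by simp
  next
    case False
    then obtain z where z: "x < z" "z < y" using less.prems by (auto simp: covers_def)
    have "{w. x < w \<and> w < z} \<subset> {w. x < w \<and> w < y}" "{w. z < w \<and> w < y} \<subset> {w. x < w \<and> w < y}"
      using z by (force dest: less_trans)+
    then have "r x < r z" "r z < r y"
      by (auto intro!: less.hyps psubset_card_mono z)
    then show ?thesis by simp
  qed
qed

text \<open>Joins need not exist in a meet semi-lattice, but here \<open>x\<close> bounds both
  parts. This produces the pair \<open>y\<close>, \<open>z\<close> to which submodularity is
  applied.\<close>

lemma isLub_Un: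
  assumes "isLub UNIV (S \<union> T) x"
  obtains y z :: 'a where "isLub UNIV S y" "isLub UNIV T z" "isLub UNIV {y, z} x" "y \<le> x" "z \<le> x"
proof -
  have "\<forall>s\<in>S. s \<le> x" "\<forall>s\<in>T. s \<le> x" using assms by (auto simp: isLub_UNIV_iff)
  then obtain y z where yz: "isLub UNIV S y" "isLub UNIV T z" "y \<le> x" "z \<le> x"
    using bounded_has_lub by meson
  moreover have "isLub UNIV {y, z} x"
    using assms yz unfolding isLub_UNIV_iff
    by (metis (full_types) Un_iff insert_iff order_trans empty_iff)
  ultimately show thesis using that by blast
qed

text \<open>By submodularity, adding one atom raises the rank of the join by at most 1.\<close>

lemma rank_le_card:
  assumes "finite S" "S \<subseteq> atoms" "isLub UNIV S x"
  shows "r x \<le> card S"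
  using assms
proof (induction S arbitrary: x rule: finite_induct)
  case empty
  then have "x = bot" by (auto simp: isLub_UNIV_iff intro: bot_unique[THEN iffD1])
  then show ?case by (simp add: rank_bot)
next
  case (insert a S)
  have "isLub UNIV (S \<union> {a}) x" using insert by simp
  then obtain y z where yz: "isLub UNIV S y" "isLub UNIV {a} z" "isLub UNIV {y, z} x"
    by (rule isLub_Un)
  then have "z = a" by (auto simp: isLub_UNIV_iff intro: antisym)
  then have "r x \<le> r y + 1"
    using submodular[OF yz(3)] rank_atom[of a] insert.prems by simp
  then show ?case using insert.IH[OF _ yz(1)] insert.prems insert.hyps by simp
qed

text \<open>With \<open>y\<close> and \<open>z\<close> the joins of \<open>S\<close> and
  \<open>U - S\<close>, the chain \<open>r x <= r y + r z <= card S + card (U - S) = r x\<close>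
  forces equality throughout.\<close>

lemma subset_of_basis:
  assumes "U \<in> bases r x" "S \<subseteq> U"
  obtains y where "S \<in> bases r y"
proof -
  have "isLub UNIV (S \<union> (U - S)) x" using assms by (simp add: bases_def Un_absorb1)
  then obtain y z where yz: "isLub UNIV S y" "isLub UNIV (U - S) z" "isLub UNIV {y, z} x"
    by (rule isLub_Un)
  have at: "S \<subseteq> atoms" "U - S \<subseteq> atoms" using assms by (auto simp: bases_def)
  have "r x \<le> r y + r z" using submodular[OF yz(3)] by simp
  moreover have "r y \<le> card S" "r z \<le> card (U - S)"
    using rank_le_card yz at by auto
  moreover have "r x = card S + card (U - S)"
    using assms card_mono[of U S] by (auto simp: bases_def card_Diff_subset)
  ultimately have "S \<in> bases r y" using yz at by (simp add: bases_def)
  then show thesis using that by blast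
qed

text \<open>Take a maximal \<open>y\<close> below \<open>x\<close> that has a basis. If
  \<open>y\<close> differs from \<open>x\<close>, atomicity supplies an atom \<open>a\<close> below
  \<open>x\<close> but not below \<open>y\<close>, and a basis of \<open>y\<close> together with
  \<open>a\<close> is a basis of a larger element below \<open>x\<close>.\<close>

lemma basis_exists: "bases r x \<noteq> {}"
proof -
  define P where "P = {y. y \<le> x \<and> bases r y \<noteq> {}}"
  have "isLub UNIV {} (bot :: 'a)" by (simp add: isLub_UNIV_iff)
  then have "{} \<in> bases r bot" by (simp add: bases_def rank_bot)
  then have "bot \<in> P" by (auto simp: P_def)
  then obtain y where y: "y \<in> P" "\<And>z. z \<in> P \<Longrightarrow> y \<le> z \<Longrightarrow> y = z"
    using finite_has_maximal[of P] by auto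
  have "y = x"
  proof (rule ccontr)
    assume "y \<noteq> x"
    obtain A where A: "A \<subseteq> atoms" "isLub UNIV A x" using atomic by blast
    have "\<not> x \<le> y" using y \<open>y \<noteq> x\<close> by (auto simp: P_def)
    then obtain a where a: "a \<in> A" "\<not> a \<le> y" using A unfolding isLub_UNIV_iff by blast
    have ax: "a \<le> x" "a \<in> atoms" using a A by (auto simp: isLub_UNIV_iff)
    obtain z where z: "isLub UNIV {y, a} z" "z \<le> x"
      using bounded_has_lub[of "{y, a}" x] y ax by (auto simp: P_def)
    \<comment> \<open>Submodularity bounds the rank from above and strict monotonicity from below,
      so the rank rises by exactly 1.\<close>
    have "r z \<le> r y + 1" using submodular[OF z(1)] rank_atom ax by simp
    moreover have "y < z" using z a by (auto simp: isLub_UNIV_iff less_le)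
    ultimately have rz: "r z = r y + 1" using rank_strict_mono[of y z] by simp
    obtain S where S: "S \<in> bases r y" using y by (auto simp: P_def)
    have "a \<notin> S" using S a by (auto simp: bases_def isLub_UNIV_iff)
    moreover have "isLub UNIV (insert a S) z"
      using S z unfolding bases_def isLub_UNIV_iff by (auto intro: order_trans)
    ultimately have "insert a S \<in> bases r z" using S rz ax by (auto simp: bases_def)
    then have "z \<in> P" using z by (auto simp: P_def)
    then show False using y(2)[of z] \<open>y < z\<close> by (simp add: less_le)
  qed
  then show ?thesis using y(1) by (simp add: P_def)
qed

text \<open>The right-hand side does not mention \<^term>\<open>S\<close>: this makes the kernel of the quotient
  map below an ideal.\<close>

lemma extended_basis_iff:
  assumes "S \<in> bases r y"
  shows "S \<inter> T = {} \<and> S \<union> T \<in> bases r x \<longleftrightarrow>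
    T \<subseteq> atoms \<and> isLub UNIV (insert y T) x \<and> r x = r y + card T"
proof -
  have S: "S \<subseteq> atoms" "isLub UNIV S y" "card S = r y" using assms by (auto simp: bases_def)
  have lub: "isLub UNIV (S \<union> T) x \<longleftrightarrow> isLub UNIV (insert y T) x"
    using S(2) unfolding isLub_UNIV_iff Un_iff insert_iff
    by (smt (verit, best) Un_iff insert_iff order_trans)
  show ?thesis
  proof
    assume "S \<inter> T = {} \<and> S \<union> T \<in> bases r x"
    then show "T \<subseteq> atoms \<and> isLub UNIV (insert y T) x \<and> r x = r y + card T"
      using S lub by (auto simp: bases_def card_Un_disjoint)
  next
    assume *: "T \<subseteq> atoms \<and> isLub UNIV (insert y T) x \<and> r x = r y + card T"
    \<comment> \<open>Since \<open>r x = card S + card T\<close>, this bound leaves no room for a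
      common element of \<open>S\<close> and \<open>T\<close>.\<close>
    then have "r x \<le> card (S \<union> T)" using rank_le_card[of "S \<union> T" x] S lub by auto
    then have c: "card (S \<union> T) = r x" "card (S \<inter> T) = 0"
      using * card_Un_Int[of S T] S(3) by auto
    then show "S \<inter> T = {} \<and> S \<union> T \<in> bases r x" using S * lub by (simp add: bases_def)
  qed
qed

end

section \<open>The quotient map\<close>

text \<open>The values lie in a commutative ring and not only in a field, because \<open>phi\<close>
  is also applied to functions with integer polynomials as values.\<close>

definition phi :: "('a::{finite,order_bot} \<Rightarrow> nat) \<Rightarrow> ('a set \<Rightarrow> 'r::comm_ring_1) \<Rightarrow> 'a \<Rightarrow> 'r"
  where "phi r w x = (\<Sum>S\<in>bases r x. w S)"

text \<open>The exterior product without signs, which is the exterior product in characteristic 2.\<close>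

definition mul :: "('a set \<Rightarrow> 'r::comm_ring_1) \<Rightarrow> ('a set \<Rightarrow> 'r) \<Rightarrow> 'a set \<Rightarrow> 'r"
  where "mul v w U = (\<Sum>S\<in>Pow U. v S * w (U - S))"

lemma phi_add: "phi r (v + w) = phi r v + phi r w"
  and phi_diff: "phi r (v - w) = phi r v - phi r w"
  and phi_zero: "phi r 0 = 0"
  and phi_fscale: "phi r (fscale c u) = fscale c (phi r u)"
  by (auto simp: phi_def fun_eq_iff fscale_def sum.distrib sum_subtractf sum_distrib_left)

lemma mul_commute: "mul v w = mul w v"
proof
  fix U
  show "mul v w U = mul w v U"
    unfolding mul_def
    by (rule sum.reindex_bij_witness[of _ "\<lambda>S. U - S" "\<lambda>S. U - S"])
      (auto simp: double_diff ac_simps)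
qed

text \<open>The pairs of a basis \<open>U\<close> of \<open>x\<close> and a subset \<open>S\<close>
  are regrouped by \<open>T = U - S\<close> and by the join \<open>y\<close> of \<open>S\<close>. By
  \<open>extended_basis_iff\<close> the condition on \<open>T\<close> and \<open>y\<close> is the
  same for every basis \<open>S\<close> of \<open>y\<close>, so the sum over \<open>S\<close>
  collapses to \<open>phi r v y\<close>. Thus the product depends on \<open>v\<close> only through
  \<open>phi r v\<close>.\<close>

lemma (in geometric_lattice) phi_mul:
  "phi r (mul v w) x = (\<Sum>T | T \<subseteq> atoms.
    \<Sum>y | isLub UNIV (insert y T) x \<and> r x = r y + card T. w T * phi r v y)"
proof -
  have "phi r (mul v w) x = (\<Sum>(U, S)\<in>Sigma (bases r x) Pow. v S * w (U - S))"
    by (simp add: phi_def mul_def sum.Sigma)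
  also have "\<dots> = (\<Sum>(T, y, S)\<in>(SIGMA T:{T. T \<subseteq> atoms}.
      SIGMA y:{y. isLub UNIV (insert y T) x \<and> r x = r y + card T}. bases r y). w T * v S)"
  proof (rule sum.reindex_bij_witness[of _
      "\<lambda>(T, y, S). (S \<union> T, S)" "\<lambda>(U, S). (U - S, THE y. S \<in> bases r y, S)"])
    have the: "(THE y. S \<in> bases r y) = y" if "S \<in> bases r y" for S y
      using that by (blast intro: bases_unique)
    fix p assume "p \<in> Sigma (bases r x) Pow"
    then obtain U S where p: "p = (U, S)" "U \<in> bases r x" "S \<subseteq> U" by blast
    obtain y where y: "S \<in> bases r y" using subset_of_basis[OF p(2,3)] .
    have "S \<inter> (U - S) = {} \<and> S \<union> (U - S) \<in> bases r x" using p by (auto simp: Un_absorb1)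
    then show "(case p of (U, S) \<Rightarrow> (U - S, THE y. S \<in> bases r y, S)) \<in> (SIGMA T:{T. T \<subseteq> atoms}.
      SIGMA y:{y. isLub UNIV (insert y T) x \<and> r x = r y + card T}. bases r y)"
      using p y extended_basis_iff[OF y, of "U - S" x] by (simp add: the)
    show "(case case p of (U, S) \<Rightarrow> (U - S, THE y. S \<in> bases r y, S) of (T, y, S) \<Rightarrow> (S \<union> T, S)) = p"
      using p by auto
    show "(case case p of (U, S) \<Rightarrow> (U - S, THE y. S \<in> bases r y, S) of (T, y, S) \<Rightarrow> w T * v S)
      = (case p of (U, S) \<Rightarrow> v S * w (U - S))"
      using p by (simp add: mult.commute)
  next
    have the: "(THE y. S \<in> bases r y) = y" if "S \<in> bases r y" for S y
      using that by (blast intro: bases_unique)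
    fix q assume "q \<in> (SIGMA T:{T. T \<subseteq> atoms}.
      SIGMA y:{y. isLub UNIV (insert y T) x \<and> r x = r y + card T}. bases r y)"
    then obtain T y S where q: "q = (T, y, S)" "T \<subseteq> atoms" "isLub UNIV (insert y T) x"
      "r x = r y + card T" "S \<in> bases r y" by blast
    then have "S \<inter> T = {}" "S \<union> T \<in> bases r x" using extended_basis_iff[OF q(5), of T x] by auto
    then show "(case q of (T, y, S) \<Rightarrow> (S \<union> T, S)) \<in> Sigma (bases r x) Pow"
      "(case case q of (T, y, S) \<Rightarrow> (S \<union> T, S) of (U, S) \<Rightarrow> (U - S, THE y. S \<in> bases r y, S)) = q"
      using q by (auto simp: the)
  qed
  also have "\<dots> = (\<Sum>T | T \<subseteq> atoms. \<Sum>y | isLub UNIV (insert y T) x \<and> r x = r y + card T.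
      \<Sum>S\<in>bases r y. w T * v S)"
    by (simp add: sum.Sigma)
  finally show ?thesis by (simp add: phi_def sum_distrib_left)
qed

lemma (in geometric_lattice) phi_mul_zero: "phi r v = 0 \<Longrightarrow> phi r (mul v w) = 0"
  by (rule ext) (simp add: phi_mul)

lemma (in geometric_lattice) phi_mul_zero_right: "phi r w = 0 \<Longrightarrow> phi r (mul v w) = 0"
  by (subst mul_commute) (rule phi_mul_zero)

section \<open>Products of vectors without signs\<close>

definition vmul :: "('a \<Rightarrow> 'r::comm_ring_1) \<Rightarrow> ('a set \<Rightarrow> 'r) \<Rightarrow> 'a set \<Rightarrow> 'r"
  where "vmul v w U = (\<Sum>u\<in>U. v u * w (U - {u}))"

definition vprod :: "('a \<Rightarrow> 'r::comm_ring_1) list \<Rightarrow> 'a set \<Rightarrow> 'r"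
  where "vprod vs = foldr vmul vs (\<lambda>S. if S = {} then 1 else 0)"

text \<open>These are the coordinates of the basis element \<open>e_S\<close> of the exterior
  algebra.\<close>

definition std :: "'a set \<Rightarrow> 'a set \<Rightarrow> 'r::comm_ring_1"
  where "std S = (\<lambda>U. if U = S then 1 else 0)"

lemma vprod_Nil: "vprod [] = std {}"
  and vprod_Cons: "vprod (v # vs) = vmul v (vprod vs)"
  by (simp_all add: vprod_def std_def)

lemma char_2_minus_one:
  assumes "CHAR('k::field) = 2"
  shows "(- 1 :: 'k) = 1"
  by (rule uminus_CHAR_2[OF assms])

lemma wedge_char_2:
  fixes v w :: "'a set \<Rightarrow> 'k::field"
  assumes "CHAR('k) = 2"
  shows "wedge ord v w = mul v w"
  by (rule ext) (simp add: wedge_def mul_def char_2_minus_one[OF assms])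

lemma mul_ext_vec: "mul (ext_vec v) w U = vmul v w U" if "finite U"
proof -
  have "mul (ext_vec v) w U = (\<Sum>S\<in>(\<lambda>u. {u}) ` U. ext_vec v S * w (U - S))"
    unfolding mul_def using that
    by (intro sum.mono_neutral_right) (auto simp: ext_vec_def is_singleton_def)
  also have "\<dots> = vmul v w U"
    by (subst sum.reindex) (auto simp: vmul_def ext_vec_def)
  finally show ?thesis .
qed

lemma wedge_list_char_2:
  fixes vs :: "('a::finite \<Rightarrow> 'k::field) list"
  assumes "CHAR('k) = 2"
  shows "wedge_list ord vs = vprod vs"
proof (induction vs)
  case Nil
  then show ?case by (simp add: wedge_list_def vprod_def ext_one_def fun_eq_iff)
next
  case (Cons v vs)
  then show ?case
    by (auto simp: wedge_list_def vprod_def wedge_char_2[OF assms] mul_ext_vec)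
qed

lemma vprod_unit_vec:
  fixes xs :: "'a::finite list"
  assumes "distinct xs"
  shows "vprod (map unit_vec xs) = (std (set xs) :: 'a set \<Rightarrow> 'k::field)"
  using assms
proof (induction xs)
  case Nil
  then show ?case by (simp add: vprod_Nil)
next
  case (Cons u xs)
  have "vmul (unit_vec u) w U = (if u \<in> U then w (U - {u}) else 0)"
    for w :: "'a set \<Rightarrow> 'k" and U
    by (simp add: vmul_def unit_vec_def if_distrib[of "\<lambda>c. c * _"] cong: if_cong)
  then show ?case using Cons by (auto simp: vprod_Cons std_def fun_eq_iff)
qed

section \<open>The standard basis elements as products of atoms\<close>

lemma linear_order_on_has_min:
  assumes "linear_order_on A ord" "finite S" "S \<noteq> {}" "S \<subseteq> A"
  shows "\<exists>m\<in>S. \<forall>s\<in>S. (m, s) \<in> ord"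
proof -
  have ord: "\<And>x. x \<in> A \<Longrightarrow> (x, x) \<in> ord" "trans ord"
    "\<And>x y. x \<in> A \<Longrightarrow> y \<in> A \<Longrightarrow> x \<noteq> y \<Longrightarrow> (x, y) \<in> ord \<or> (y, x) \<in> ord"
    using assms(1)
    by (auto simp: linear_order_on_def partial_order_on_def preorder_on_def refl_on_def total_on_def)
  show ?thesis using assms(2-)
  proof (induction S rule: finite_ne_induct)
    case (singleton x)
    then show ?case using ord by simp
  next
    case (insert x F)
    then obtain m where m: "m \<in> F" "\<forall>s\<in>F. (m, s) \<in> ord" by blast
    show ?case
    proof (cases "(x, m) \<in> ord")
      case True
      then show ?thesis using m ord insert.prems by (auto dest: transD)
    next
      case False
      then have "(m, x) \<in> ord" using ord(1,3) m insert.prems by blast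
      then show ?thesis using m by auto
    qed
  qed
qed

text \<open>The definite description is justified here. A sorted list is built by splitting off a
  minimum, and antisymmetry forces two sorted lists of the same set to have equal heads.\<close>

lemma increasing_list:
  assumes lin: "linear_order_on A ord" and "finite S" "S \<subseteq> A"
  shows "distinct (increasing_list ord S)" "set (increasing_list ord S) = S"
proof -
  let ?P = "\<lambda>S xs. distinct xs \<and> set xs = S \<and> sorted_wrt (\<lambda>x y. (x, y) \<in> ord) xs"
  have "\<exists>xs. ?P S xs"
    using assms(2,3)
  proof (induction "card S" arbitrary: S)
    case 0
    then show ?case by simp
  next
    case (Suc n)
    then obtain m where m: "m \<in> S" "\<forall>s\<in>S. (m, s) \<in> ord"
      using linear_order_on_has_min[OF lin, of S] by fastforce
    have "n = card (S - {m})" using Suc.hyps(2) Suc.prems m by simp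
    then obtain xs where "?P (S - {m}) xs" using Suc.hyps(1)[of "S - {m}"] Suc.prems by blast
    then show ?case using m by (intro exI[of _ "m # xs"]) auto
  qed
  then obtain xs where xs: "?P S xs" ..
  have unique: "xs = ys" if "?P S xs" "?P S ys" for S xs ys
    using that
  proof (induction xs arbitrary: S ys)
    case Nil
    then show ?case by auto
  next
    case (Cons x xs)
    then obtain y ys' where ys: "ys = y # ys'" by (cases ys) auto
    have "x = y"
    proof (rule ccontr)
      assume "x \<noteq> y"
      then have "x \<in> set ys'" "y \<in> set xs" using Cons.prems ys by auto
      then have "(x, y) \<in> ord" "(y, x) \<in> ord" using Cons.prems ys by auto
      then show False
        using \<open>x \<noteq> y\<close> lin
        by (auto simp: linear_order_on_def partial_order_on_def dest: antisymD)
    qed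
    moreover have "xs = ys'"
      using Cons.prems ys \<open>x = y\<close> by (intro Cons.IH[of "set xs"]) auto
    ultimately show ?case using ys by simp
  qed
  have "increasing_list ord S = xs"
    unfolding increasing_list_def
  proof (rule the_equality)
    show "ys = xs" if "?P S ys" for ys by (rule unique[OF that xs])
  qed (rule xs)
  then show "distinct (increasing_list ord S)" "set (increasing_list ord S) = S" using xs by auto
qed

text \<open>From here on the generators of the ideal do not depend on the order of the
  atoms.\<close>

lemma e_wedge_char_2:
  fixes S :: "'a::{finite,order_bot} set"
  assumes "CHAR('k::field) = 2" "linear_order_on atoms ord" "S \<subseteq> atoms"
  shows "e_wedge ord S = (std S :: 'a set \<Rightarrow> 'k)"
  unfolding e_wedge_def using increasing_list[OF assms(2) _ assms(3)]
  by (simp add: wedge_list_char_2[OF assms(1)] vprod_unit_vec)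

section \<open>The ideal as the kernel of \<open>phi\<close>\<close>

lemma phi_std: "phi r (std S) x = (if S \<in> bases r x then 1 else 0)"
  by (simp add: phi_def std_def)

lemma std_in_ext_space: "S \<subseteq> A \<Longrightarrow> std S \<in> ext_space A"
  by (auto simp: std_def ext_space_def)

lemma ext_space_iff: "w \<in> ext_space A \<longleftrightarrow> (\<forall>S. \<not> S \<subseteq> A \<longrightarrow> w S = 0)"
  by (auto simp: ext_space_def)

lemma ext_space_closed:
  shows "0 \<in> ext_space A"
    and "v \<in> ext_space A \<Longrightarrow> w \<in> ext_space A \<Longrightarrow> v + w \<in> ext_space A"
    and "v \<in> ext_space A \<Longrightarrow> w \<in> ext_space A \<Longrightarrow> v - w \<in> ext_space A"
    and "v \<in> ext_space A \<Longrightarrow> fscale c v \<in> ext_space A"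
  by (simp_all add: ext_space_iff fscale_def)

lemma subspace_ext_space: "fun_vs.subspace (ext_space A)"
  by (simp add: fun_vs.subspace_def ext_space_closed)

lemma mul_in_ext_space:
  assumes "v \<in> ext_space A" "w \<in> ext_space A"
  shows "mul v w \<in> ext_space A"
  unfolding ext_space_def
proof (intro CollectI allI impI)
  fix U assume "mul v w U \<noteq> 0"
  then obtain S where "S \<in> Pow U" "v S * w (U - S) \<noteq> 0"
    unfolding mul_def by (meson sum.not_neutral_contains_not_neutral)
  then have "S \<subseteq> A" "U - S \<subseteq> A" using assms by (auto simp: ext_space_def)
  then show "U \<subseteq> A" by blast
qed

text \<open>The kernel of \<open>phi\<close> in the exterior algebra is itself an ideal, by
  \<open>phi_mul_zero\<close>, so the hull lies in it once the generators do.\<close>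

lemma (in geometric_lattice) L_ideal_subset:
  fixes w :: "'a set \<Rightarrow> 'k::field"
  assumes k: "CHAR('k) = 2" and ord: "linear_order_on atoms ord" and w: "w \<in> L_ideal r ord"
  shows "phi r w = 0"
proof -
  let ?I = "{w :: 'a set \<Rightarrow> 'k. w \<in> ext_space atoms \<and> phi r w = 0}"
  have "ext_ideal ord atoms ?I"
    unfolding ext_ideal_def wedge_char_2[OF k]
    by (auto simp: ext_space_closed mul_in_ext_space phi_zero phi_add phi_mul_zero
        phi_mul_zero_right)
  \<comment> \<open>Sets in the first two families are bases of no element; in the third family both
    sets are bases of the same \<open>x\<close>, and their images cancel.\<close>
  moreover have "L_generators r ord \<subseteq> ?I"
    unfolding L_generators_def hat_join_eq_Value_iff hat_join_eq_Top_iff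
    by (auto simp: e_wedge_char_2[OF k ord] std_in_ext_space ext_space_closed phi_diff phi_std
        bases_def intro!: ext) (metis isLub_UNIV_unique)+
  ultimately have "L_ideal r ord \<subseteq> ?I"
    unfolding L_ideal_def by (simp add: hull_minimal)
  then show ?thesis using w by auto
qed

lemma (in geometric_lattice) diff_generator:
  assumes "S \<in> bases r x" "T \<in> bases r x" "S \<noteq> T"
  shows "e_wedge ord S - e_wedge ord T \<in> L_generators r ord"
proof -
  have "S \<subseteq> atoms \<and> T \<subseteq> atoms \<and> S \<noteq> T \<and>
      isLub UNIV S x \<and> isLub UNIV T x \<and> r x = card S \<and> r x = card T"
    using assms by (simp add: bases_def)
  then show ?thesis
    unfolding L_generators_def hat_join_eq_Value_iff by blast
qed

text \<open>A set of atoms that is no basis has either no join or a join of the wrong rank, so it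
  falls under one of the first two families of generators.\<close>

lemma (in geometric_lattice) nonbasis_generator:
  assumes "S \<subseteq> atoms" "\<And>x. S \<notin> bases r x"
  shows "e_wedge ord S \<in> L_generators r ord"
proof -
  have "(\<forall>x. \<not> isLub UNIV S x) \<or> (\<exists>x. isLub UNIV S x \<and> r x \<noteq> card S)"
    using assms by (auto simp: bases_def)
  then show ?thesis
    unfolding L_generators_def hat_join_eq_Value_iff hat_join_eq_Top_iff using assms(1) by blast
qed

lemma ext_ideal_sum:
  assumes "ext_ideal ord A I" "\<And>s. s \<in> S \<Longrightarrow> f s \<in> I"
  shows "sum f S \<in> I"
proof (cases "finite S")
  case True
  then show ?thesis using assms(2)
    by (induction S rule: finite_induct) (use assms(1) in \<open>auto simp: ext_ideal_def\<close>)
next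
  case False
  then show ?thesis using assms(1) by (simp add: ext_ideal_def)
qed

text \<open>\<open>ext_ideal\<close> does not list closure under scalars; it follows by multiplying
  with \<open>c\<close> times the unit of the algebra.\<close>

lemma ext_ideal_fscale:
  fixes w :: "'a::finite set \<Rightarrow> 'k::field"
  assumes "CHAR('k) = 2" "ext_ideal ord A I" "w \<in> I"
  shows "fscale c w \<in> I"
proof -
  have "fscale c (std {}) \<in> ext_space A" by (simp add: ext_space_closed std_in_ext_space)
  then have "mul (fscale c (std {})) w \<in> I"
    using assms(2,3) unfolding ext_ideal_def wedge_char_2[OF assms(1)] by blast
  moreover have "mul (fscale c (std {})) w = fscale c w"
    by (simp add: mul_def fscale_def std_def fun_eq_iff if_distrib[of "\<lambda>c. _ * c"]
        if_distrib[of "\<lambda>c. c * _"] cong: if_cong)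
  ultimately show ?thesis by simp
qed

lemma sum_apply: "(\<Sum>s\<in>S. f s) x = (\<Sum>s\<in>S. f s x)"
  by (induction S rule: infinite_finite_induct) simp_all

text \<open>Fix one basis \<open>B x\<close> for each \<open>x\<close>. Modulo the ideal, every
  \<open>e_S\<close> equals its representative \<open>c S\<close>. Rewriting \<open>w\<close> in
  this way gives \<open>B x\<close> the coefficient \<open>phi r w x\<close>, which is 0, so
  \<open>w\<close> is congruent to 0.\<close>

lemma (in geometric_lattice) L_ideal_supset:
  fixes w :: "'a set \<Rightarrow> 'k::field"
  assumes k: "CHAR('k) = 2" and ord: "linear_order_on atoms ord"
    and w: "w \<in> ext_space atoms" "phi r w = 0"
  shows "w \<in> L_ideal r ord"
proof -
  obtain B where B: "\<And>x. B x \<in> bases r x"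
  proof
    show "(SOME S. S \<in> bases r x) \<in> bases r x" for x
      using basis_exists[of x] by (auto intro: someI_ex)
  qed
  \<comment> \<open>The representative of \<open>e_S\<close>: the chosen \<open>e_(B x)\<close> if
    \<open>S\<close> is a basis of \<open>x\<close>, and 0 if \<open>S\<close> is no basis.\<close>
  define c where "c S = (\<lambda>U. if \<exists>x. S \<in> bases r x \<and> U = B x then 1 else 0 :: 'k)" for S
  have std_c: "std S - c S \<in> I" if I: "ext_ideal ord atoms I" "L_generators r ord \<subseteq> I" and S: "S \<subseteq> atoms"
    for I S
  proof (cases "\<exists>x. S \<in> bases r x")
    case True
    then obtain x where x: "S \<in> bases r x" by blast
    have "S \<in> bases r y \<longleftrightarrow> y = x" for y using x bases_unique by blast
    then have "c S = std (B x)" by (simp add: c_def std_def)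
    moreover have "std S - std (B x) \<in> I"
    proof (cases "S = B x")
      case True
      then show ?thesis using I by (simp add: ext_ideal_def)
    next
      case False
      have "B x \<subseteq> atoms" using B[of x] by (simp add: bases_def)
      then show ?thesis
        using I(2) diff_generator[OF x B[of x] False, of ord] e_wedge_char_2[OF k ord, of S]
          e_wedge_char_2[OF k ord, of "B x"] S by (metis subsetD)
    qed
    ultimately show ?thesis by simp
  next
    case False
    then have "e_wedge ord S \<in> (L_generators r ord :: ('a set \<Rightarrow> 'k) set)"
      using S by (intro nonbasis_generator) auto
    moreover have "c S = 0" using False by (auto simp: c_def fun_eq_iff)
    ultimately show ?thesis using I(2) e_wedge_char_2[OF k ord S] by auto
  qed
  have c0: "(\<Sum>S\<in>Pow atoms. w S * c S U) = 0" for U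
  proof (cases "\<exists>x. U = B x")
    case True
    then obtain x where x: "U = B x" by blast
    have "U = B y \<longleftrightarrow> y = x" for y using x B bases_unique by metis
    then have "(\<Sum>S\<in>Pow atoms. w S * c S U) = (\<Sum>S\<in>bases r x. w S)"
      by (intro sum.mono_neutral_cong_right) (auto simp: c_def bases_def)
    then show ?thesis using w(2) by (simp add: phi_def fun_eq_iff)
  next
    case False
    then show ?thesis by (auto simp: c_def)
  qed
  have "w U = (\<Sum>S\<in>Pow atoms. fscale (w S) (std S - c S)) U" for U
  proof -
    have "(\<Sum>S\<in>Pow atoms. w S * std S U) = w U"
      using w(1) by (auto simp: std_def ext_space_def if_distrib[of "\<lambda>c. _ * c"] cong: if_cong)
    moreover have "(\<Sum>S\<in>Pow atoms. fscale (w S) (std S - c S)) U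
        = (\<Sum>S\<in>Pow atoms. w S * std S U) - (\<Sum>S\<in>Pow atoms. w S * c S U)"
      by (simp add: fscale_def algebra_simps sum_subtractf sum_apply)
    ultimately show ?thesis by (simp add: c0)
  qed
  \<comment> \<open>The subtracted terms add up to 0 by \<open>c0\<close>, so \<open>w\<close> is a
    combination of differences that lie in every ideal containing the generators.\<close>
  then have "w = (\<Sum>S\<in>Pow atoms. fscale (w S) (std S - c S))" by blast
  moreover have "\<dots> \<in> I" if "ext_ideal ord atoms I" "L_generators r ord \<subseteq> I" for I
    using that by (intro ext_ideal_sum[OF that(1)] ext_ideal_fscale[OF k that(1)] std_c) auto
  ultimately show ?thesis unfolding L_ideal_def hull_def by auto
qed

section \<open>The family \<open>Delta\<close> in terms of \<open>phi\<close>\<close>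

definition bprod :: "(nat \<Rightarrow> 'a \<Rightarrow> 'r::comm_ring_1) \<Rightarrow> nat set \<Rightarrow> 'a set \<Rightarrow> 'r"
  where "bprod b S = vprod (map b (sorted_list_of_set S))"

lemma module_hom_phi: "module_hom fscale fscale (phi r)"
  by unfold_locales (simp_all add: phi_add phi_fscale)

lemma vprod_in_ext_space:
  assumes "\<And>v. v \<in> set vs \<Longrightarrow> v \<in> vec_space A"
  shows "vprod vs \<in> ext_space (A :: 'a::finite set)"
  using assms
proof (induction vs)
  case Nil
  then show ?case by (simp add: vprod_Nil std_in_ext_space)
next
  case (Cons v vs)
  have "ext_vec v \<in> ext_space A"
    using Cons.prems[of v] by (auto simp: ext_vec_def ext_space_def vec_space_def is_singleton_def)
  then have "mul (ext_vec v) (vprod vs) \<in> ext_space A"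
    using Cons by (intro mul_in_ext_space) auto
  moreover have "mul (ext_vec v) (vprod vs) = vmul v (vprod vs)"
    by (simp add: mul_ext_vec fun_eq_iff)
  ultimately show ?case by (simp add: vprod_Cons)
qed

lemma bprod_in_ext_space:
  fixes A :: "'a::finite set"
  assumes "\<And>j. j \<in> {1..n} \<Longrightarrow> b j \<in> vec_space A" "S \<subseteq> {1..n}"
  shows "bprod b S \<in> ext_space A"
proof -
  have "finite S" using assms(2) finite_subset by blast
  then show ?thesis
    unfolding bprod_def using assms by (intro vprod_in_ext_space) auto
qed

text \<open>Two elements have the same coset exactly if \<open>phi\<close> agrees on them.
  Membership thus becomes a span condition on functions on the semi-lattice, with no reference to
  \<open>ord\<close>.\<close>

lemma (in geometric_lattice) mem_Delta_iff:
  fixes b :: "nat \<Rightarrow> 'a \<Rightarrow> 'k::field"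
  assumes k: "CHAR('k) = 2" and ord: "linear_order_on atoms ord"
    and b: "\<And>j. j \<in> {1..card (atoms :: 'a set)} \<Longrightarrow> b j \<in> vec_space atoms"
  shows "S \<in> Delta r ord b \<longleftrightarrow> S \<subseteq> {1..card (atoms :: 'a set)} \<and>
    phi r (bprod b S) \<notin> fun_vs.span ((\<lambda>T. phi r (bprod b T)) `
      {T. T \<subseteq> {1..card (atoms :: 'a set)} \<and> card T = card S \<and> lex_less T S})"
proof -
  let ?X = "{T. T \<subseteq> {1..card (atoms :: 'a set)} \<and> card T = card S \<and> lex_less T S}"
  have proj: "L_proj r ord v = L_proj r ord w \<longleftrightarrow> phi r v = phi r w"
    if "v \<in> ext_space atoms" "w \<in> ext_space atoms" for v w :: "'a set \<Rightarrow> 'k"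
  proof -
    have "u - v \<in> L_ideal r ord \<longleftrightarrow> phi r u = phi r v"
      if "u \<in> ext_space atoms" "v \<in> ext_space atoms" for u v :: "'a set \<Rightarrow> 'k"
      using L_ideal_subset[OF k ord, of "u - v"] L_ideal_supset[OF k ord, of "u - v"] that
      by (auto simp: phi_diff ext_space_closed)
    then have "L_proj r ord v = {u \<in> ext_space atoms. phi r u = phi r v}"
      if "v \<in> ext_space atoms" for v :: "'a set \<Rightarrow> 'k"
      unfolding L_proj_def using that by blast
    then show ?thesis using that by auto
  qed
  have bw: "b_wedge ord b T = bprod b T" for T
    by (simp add: b_wedge_def bprod_def wedge_list_char_2[OF k])
  have sp: "fun_vs.span (bprod b ` ?X) \<subseteq> ext_space atoms"
    using bprod_in_ext_space[of "card (atoms :: 'a set)" b, OF b]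
    by (intro fun_vs.span_minimal subspace_ext_space) blast
  have mem: "L_proj r ord (bprod b S) \<in> L_proj r ord ` fun_vs.span (bprod b ` ?X) \<longleftrightarrow>
      phi r (bprod b S) \<in> phi r ` fun_vs.span (bprod b ` ?X)" if "S \<subseteq> {1..card (atoms :: 'a set)}"
    using proj[OF bprod_in_ext_space[of _ b, OF b that]] sp unfolding image_iff by blast
  have im: "phi r ` fun_vs.span (bprod b ` ?X) = fun_vs.span ((\<lambda>T. phi r (bprod b T)) ` ?X)"
    using module_hom.span_image[OF module_hom_phi, of r "bprod b ` ?X"] by (simp add: image_image)
  have gens: "{bprod b T |T. T \<subseteq> {1..card (atoms :: 'a set)} \<and> card T = card S \<and> lex_less T S}
    = bprod b ` ?X" by blast
  show ?thesis unfolding Delta_def mem_Collect_eq bw gens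
    by (subst im[symmetric]) (use mem in auto)
qed

section \<open>Permuted and repeated factors\<close>

lemma symmetric_double_sum_char_2:
  fixes f :: "'a \<Rightarrow> 'a \<Rightarrow> 'k::field"
  assumes "CHAR('k) = 2" "finite X" "\<And>x y. f x y = f y x" "\<And>x. f x x = 0"
  shows "(\<Sum>x\<in>X. \<Sum>y\<in>X. f x y) = 0"
  using assms(2)
proof (induction X rule: finite_induct)
  case (insert a X)
  have "(\<Sum>x\<in>insert a X. \<Sum>y\<in>insert a X. f x y)
      = f a a + (\<Sum>y\<in>X. f a y) + ((\<Sum>x\<in>X. f x a) + (\<Sum>x\<in>X. \<Sum>y\<in>X. f x y))"
    using insert.hyps by (simp add: sum.distrib)
  also have "\<dots> = (\<Sum>y\<in>X. f a y) + (\<Sum>x\<in>X. f a x)"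
    using insert.IH by (simp add: assms(3)[of _ a] assms(4))
  also have "\<dots> = 0"
    using uminus_CHAR_2[OF assms(1)] by (simp add: add_eq_0_iff)
  finally show ?case .
qed simp

text \<open>Letting both sums run over all of \<open>U\<close>, with zeros on the diagonal, exposes
  the symmetry: exchanging the sums proves commutation, and for equal factors the terms cancel in
  pairs in characteristic 2.\<close>

lemma vmul_vmul:
  "vmul v (vmul v' w) U =
    (\<Sum>x\<in>U. \<Sum>y\<in>U. if x = y then 0 else v x * v' y * w (U - {x, y}))" if "finite U"
proof -
  have "v x * vmul v' w (U - {x}) = (\<Sum>y\<in>U. if x = y then 0 else v x * v' y * w (U - {x, y}))"
    if "x \<in> U" for x
  proof -
    have "v x * vmul v' w (U - {x}) = (\<Sum>y\<in>U - {x}. v x * v' y * w (U - {x, y}))"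
      by (simp add: vmul_def sum_distrib_left mult.assoc Diff_insert2[symmetric] insert_commute)
    also have "\<dots> = (\<Sum>y\<in>U. if x = y then 0 else v x * v' y * w (U - {x, y}))"
      using \<open>finite U\<close> by (intro sum.mono_neutral_cong_left) auto
    finally show ?thesis .
  qed
  then show ?thesis by (simp add: vmul_def[of v])
qed

lemma vmul_left_commute:
  fixes w :: "'a::finite set \<Rightarrow> 'r::comm_ring_1"
  shows "vmul v (vmul v' w) = vmul v' (vmul v w)"
proof
  fix U
  show "vmul v (vmul v' w) U = vmul v' (vmul v w) U"
    unfolding vmul_vmul[OF finite]
    by (subst sum.swap) (intro sum.cong refl if_cong; auto simp: insert_commute mult.commute)
qed

lemma vmul_vmul_same:
  fixes w :: "'a::finite set \<Rightarrow> 'k::field"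
  assumes "CHAR('k) = 2"
  shows "vmul v (vmul v w) = 0"
proof
  fix U
  show "vmul v (vmul v w) U = 0 U"
    unfolding vmul_vmul[OF finite] zero_fun_apply
    by (intro symmetric_double_sum_char_2[OF assms]) (auto simp: insert_commute mult.commute)
qed

text \<open>Factors commute, so the place where \<open>j\<close> enters the sorted list is
  immaterial.\<close>

lemma vprod_insort:
  fixes b :: "nat \<Rightarrow> 'a::finite \<Rightarrow> 'r::comm_ring_1"
  shows "vprod (map b (insort j xs)) = vmul (b j) (vprod (map b xs))"
  by (induction xs) (auto simp: vprod_Cons vmul_left_commute)

lemma bprod_insert:
  fixes b :: "nat \<Rightarrow> 'a::finite \<Rightarrow> 'r::comm_ring_1"
  assumes "finite S" "j \<notin> S"
  shows "bprod b (insert j S) = vmul (b j) (bprod b S)"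
  using assms by (simp add: bprod_def sorted_list_of_set_insert_remove vprod_insort)

lemma vmul_bprod_mem:
  fixes b :: "nat \<Rightarrow> 'a::finite \<Rightarrow> 'k::field"
  assumes "CHAR('k) = 2" "finite S" "j \<in> S"
  shows "vmul (b j) (bprod b S) = 0"
proof -
  have "bprod b S = vmul (b j) (bprod b (S - {j}))"
    using bprod_insert[of "S - {j}" j b] assms by (simp add: insert_absorb)
  then show ?thesis by (simp add: vmul_vmul_same[OF assms(1)])
qed

lemma module_hom_vmul: "module_hom fscale fscale (vmul v)"
  by unfold_locales
    (auto simp: vmul_def fscale_def fun_eq_iff algebra_simps sum.distrib sum_distrib_left)

text \<open>Multiplication by \<open>v\<close> descends to the quotient because the kernel of
  \<open>phi\<close> is an ideal, so it may be applied to a linear relation that holds only after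
  \<open>phi\<close>.\<close>

lemma (in geometric_lattice) phi_vmul_span:
  fixes w :: "'a set \<Rightarrow> 'k::field"
  assumes "phi r w \<in> fun_vs.span (phi r ` X)"
  shows "phi r (vmul v w) \<in> fun_vs.span (phi r ` vmul v ` X)"
proof -
  interpret P: module_hom fscale fscale "phi r :: ('a set \<Rightarrow> 'k) \<Rightarrow> _" by (rule module_hom_phi)
  interpret V: module_hom fscale fscale "vmul v :: ('a set \<Rightarrow> 'k) \<Rightarrow> _" by (rule module_hom_vmul)
  obtain w' where w': "w' \<in> fun_vs.span X" "phi r w = phi r w'"
    using assms by (auto simp: P.span_image)
  have "vmul v (w - w') = mul (w - w') (ext_vec v)"
    by (rule ext) (simp add: mul_ext_vec mul_commute[of _ "ext_vec v"])
  then have "phi r (vmul v (w - w')) = 0"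
    using w' by (simp add: phi_mul_zero phi_diff)
  then have "phi r (vmul v w) = phi r (vmul v w')" by (simp add: V.diff phi_diff)
  then show ?thesis using w'(1) by (simp add: P.span_image V.span_image)
qed

section \<open>The lexicographic order\<close>

lemma lex_less_iff:
  assumes "finite S" "finite T"
  shows "lex_less S T \<longleftrightarrow> (\<exists>m. m \<in> S \<and> m \<notin> T \<and> (\<forall>k<m. k \<in> S \<longleftrightarrow> k \<in> T))"
proof
  let ?D = "(S - T) \<union> (T - S)"
  assume "lex_less S T"
  then have D: "?D \<noteq> {}" "Min ?D \<in> S" by (auto simp: lex_less_def)
  have "Min ?D \<in> ?D" using assms D by (intro Min_in) auto
  moreover have "k \<notin> ?D" if "k < Min ?D" for k
  proof
    assume "k \<in> ?D"
    then have "Min ?D \<le> k" using assms by (intro Min_le) auto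
    then show False using that by simp
  qed
  ultimately show "\<exists>m. m \<in> S \<and> m \<notin> T \<and> (\<forall>k<m. k \<in> S \<longleftrightarrow> k \<in> T)"
    using D(2) by (intro exI[of _ "Min ?D"]) blast
next
  let ?D = "(S - T) \<union> (T - S)"
  assume "\<exists>m. m \<in> S \<and> m \<notin> T \<and> (\<forall>k<m. k \<in> S \<longleftrightarrow> k \<in> T)"
  then obtain m where m: "m \<in> S" "m \<notin> T" "\<forall>k<m. k \<in> S \<longleftrightarrow> k \<in> T" by blast
  then have "Min ?D = m" using assms by (intro Min_eqI) (auto simp: not_less[symmetric])
  then show "lex_less S T" using m by (auto simp: lex_less_def)
qed

text \<open>The smaller of the two first differences is the first difference of \<open>S\<close> and
  \<open>U\<close>.\<close>

lemma lex_less_trans: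
  assumes "finite S" "finite T" "finite U" "lex_less S T" "lex_less T U"
  shows "lex_less S U"
proof -
  obtain a b where a: "a \<in> S" "a \<notin> T" "\<forall>k<a. k \<in> S \<longleftrightarrow> k \<in> T"
    and b: "b \<in> T" "b \<notin> U" "\<forall>k<b. k \<in> T \<longleftrightarrow> k \<in> U"
    using assms by (auto simp: lex_less_iff)
  have "a \<noteq> b" using a b by auto
  then have "min a b \<in> S \<and> min a b \<notin> U \<and> (\<forall>k<min a b. k \<in> S \<longleftrightarrow> k \<in> U)"
    using a b by (cases "a < b") (auto simp: min_def)
  then show ?thesis using assms by (auto simp: lex_less_iff)
qed

lemma lex_less_asym: "finite S \<Longrightarrow> finite T \<Longrightarrow> lex_less S T \<Longrightarrow> \<not> lex_less T S"
  using lex_less_trans[of S T S] unfolding lex_less_def[of S S] by blast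

lemma lex_less_total:
  assumes "finite S" "finite T" "S \<noteq> T"
  shows "lex_less S T \<or> lex_less T S"
proof -
  let ?D = "(S - T) \<union> (T - S)"
  have "Min ?D \<in> ?D" using assms by (intro Min_in) auto
  then show ?thesis using assms by (auto simp: lex_less_def Un_commute)
qed

section \<open>Closure under subsets\<close>

definition lex_below :: "nat \<Rightarrow> nat set \<Rightarrow> nat set set"
  where "lex_below n S = {T. T \<subseteq> {1..n} \<and> card T = card S \<and> lex_less T S}"

text \<open>This is \<open>Delta\<close> read through \<open>phi\<close>, freed from the order of
  the atoms and with the size \<open>n\<close> of the ground set as a parameter; see
  \<open>Delta_eq_shifting\<close>.\<close>

definition shifting :: "('a::{finite,order_bot} \<Rightarrow> nat) \<Rightarrow> nat \<Rightarrow> (nat \<Rightarrow> 'a \<Rightarrow> 'k::field) \<Rightarrow> nat set set"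
  where "shifting r n b = {S. S \<subseteq> {1..n} \<and>
    phi r (bprod b S) \<notin> fun_vs.span ((\<lambda>T. phi r (bprod b T)) ` lex_below n S)}"

lemma lex_below_insert:
  assumes "S \<subseteq> {1..n}" "j \<in> {1..n}" "j \<notin> S" "U \<in> lex_below n S" "j \<notin> U"
  shows "insert j U \<in> lex_below n (insert j S)"
proof -
  have fin: "finite U" "finite S" using assms by (auto simp: lex_below_def intro: finite_subset)
  have "lex_less U S" using assms(4) by (simp add: lex_below_def)
  then have "lex_less (insert j U) (insert j S)"
    using assms(3,5) fin by (auto simp: lex_less_iff)
  then show ?thesis using assms fin by (auto simp: lex_below_def)
qed

text \<open>Contrapositive: multiply a relation that expresses \<open>b_S\<close> by smaller
  \<open>b_U\<close> with \<open>b_j\<close>. Terms with \<open>j\<close> in \<open>U\<close>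
  vanish, and the others become products for sets lexicographically below
  \<open>insert j S\<close>.\<close>

lemma (in geometric_lattice) shifting_remove:
  fixes b :: "nat \<Rightarrow> 'a \<Rightarrow> 'k::field"
  assumes k: "CHAR('k) = 2" and S: "insert j S \<in> shifting r n b" "j \<notin> S"
  shows "S \<in> shifting r n b"
proof (rule ccontr)
  assume "S \<notin> shifting r n b"
  moreover have sub: "S \<subseteq> {1..n}" "j \<in> {1..n}" using S by (auto simp: shifting_def)
  ultimately have "phi r (bprod b S) \<in> fun_vs.span (phi r ` bprod b ` lex_below n S)"
    by (simp add: shifting_def image_image)
  then have *: "phi r (vmul (b j) (bprod b S)) \<in>
      fun_vs.span (phi r ` vmul (b j) ` bprod b ` lex_below n S)"
    by (rule phi_vmul_span)
  have fin: "finite S" using sub finite_subset by blast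
  let ?Y = "fun_vs.span ((\<lambda>T. phi r (bprod b T)) ` lex_below n (insert j S))"
  have "phi r (vmul (b j) (bprod b U)) \<in> ?Y" if U: "U \<in> lex_below n S" for U
  proof -
    have fU: "finite U" using U by (auto simp: lex_below_def intro: finite_subset)
    show ?thesis
    proof (cases "j \<in> U")
      case True
      then show ?thesis
        by (simp add: vmul_bprod_mem[OF k fU] phi_zero fun_vs.span_zero)
    next
      case False
      then have "vmul (b j) (bprod b U) = bprod b (insert j U)" using fU by (simp add: bprod_insert)
      then show ?thesis
        using lex_below_insert[OF sub S(2) U False] by (auto intro: fun_vs.span_base)
    qed
  qed
  then have "fun_vs.span (phi r ` vmul (b j) ` bprod b ` lex_below n S) \<subseteq> ?Y"
    by (intro fun_vs.span_minimal) auto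
  with * have "phi r (bprod b (insert j S)) \<in> ?Y"
    using S(2) fin by (auto simp: bprod_insert)
  then show False using S(1) by (simp add: shifting_def)
qed

lemma (in geometric_lattice) simplicial_shifting:
  fixes b :: "nat \<Rightarrow> 'a \<Rightarrow> 'k::field"
  assumes k: "CHAR('k) = 2"
  shows "simplicial_complex_on {1..n} (shifting r n b)"
proof -
  have empty: "{} \<in> shifting r n b"
  proof -
    \<comment> \<open>Nothing precedes the empty set, so the span in question is zero and it remains
      to see that the unit has nonzero image.\<close>
    have "T \<notin> lex_below n {}" for T
    proof
      assume T: "T \<in> lex_below n {}"
      then have "finite T" by (auto simp: lex_below_def intro: finite_subset)
      then have "T = {}" using T by (simp add: lex_below_def)
      then show False using T by (simp add: lex_below_def lex_less_def)
    qed
    then have below: "lex_below n {} = {}" by blast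
    have "{} \<in> bases r bot" by (simp add: bases_def isLub_UNIV_iff rank_bot)
    then have "phi r (bprod b {}) bot = 1" by (simp add: bprod_def vprod_Nil phi_std)
    then have "phi r (bprod b {}) \<noteq> 0" by auto
    then show ?thesis by (simp add: shifting_def below)
  qed
  have remove: "T \<in> shifting r n b"
    if "finite X" "T \<union> X \<in> shifting r n b" "T \<inter> X = {}" for T X
    using that
  proof (induction X rule: finite_induct)
    case (insert j F)
    then have "insert j (T \<union> F) \<in> shifting r n b" "j \<notin> T \<union> F" by auto
    then have "T \<union> F \<in> shifting r n b" by (rule shifting_remove[OF k])
    then show ?case using insert.IH insert.prems(2) by simp
  qed simp
  have sub: "S \<subseteq> {1..n}" if "S \<in> shifting r n b" for S
    using that by (simp add: shifting_def)
  have "T \<in> shifting r n b" if "S \<in> shifting r n b" "T \<subseteq> S" for S T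
  proof (rule remove)
    show "finite (S - T)" using sub[OF that(1)] finite_subset by blast
    show "T \<union> (S - T) \<in> shifting r n b" using that by (simp add: Un_absorb1)
  qed simp
  with empty sub show ?thesis unfolding simplicial_complex_on_def by blast
qed

section \<open>Elimination over a ring with two evaluations\<close>

definition ring_map :: "('r::comm_ring_1 \<Rightarrow> 's::comm_ring_1) \<Rightarrow> bool"
  where "ring_map f \<longleftrightarrow> f 0 = 0 \<and> f 1 = 1 \<and>
    (\<forall>x y. f (x + y) = f x + f y) \<and> (\<forall>x y. f (x * y) = f x * f y)"

lemma ring_map_diff: "ring_map f \<Longrightarrow> f (x - y) = f x - f y"
  unfolding ring_map_def by (metis add_diff_cancel_right' diff_add_cancel)

lemma ring_map_sum: "ring_map f \<Longrightarrow> f (sum g A) = (\<Sum>a\<in>A. f (g a))"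
  by (induction A rule: infinite_finite_induct) (simp_all add: ring_map_def)

text \<open>A division-free pivot step: the coordinate \<open>x\<close> of the result is 0, and
  since only ring operations occur the step commutes with ring maps.\<close>

definition eliminate :: "('i \<Rightarrow> 'r::comm_ring_1) \<Rightarrow> 'i \<Rightarrow> ('i \<Rightarrow> 'r) \<Rightarrow> 'i \<Rightarrow> 'r"
  where "eliminate w x v = (\<lambda>i. w x * v i - v x * w i)"

lemma module_hom_eliminate: "module_hom fscale fscale (eliminate w x)"
  by unfold_locales (auto simp: eliminate_def fscale_def fun_eq_iff algebra_simps)

text \<open>The map kills \<open>w\<close>, and on \<open>v\<close> it is multiplication by the
  nonzero scalar \<open>w x\<close> followed by subtraction of a multiple of
  \<open>w\<close>.\<close>

lemma span_eliminate:
  fixes v w :: "'i \<Rightarrow> 'k::field"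
  assumes "w x \<noteq> 0"
  shows "v \<in> fun_vs.span (insert w W) \<longleftrightarrow>
    eliminate w x v \<in> fun_vs.span (eliminate w x ` W)"
proof -
  interpret E: module_hom fscale fscale "eliminate w x" by (rule module_hom_eliminate)
  have E: "eliminate w x u = fscale (w x) u - fscale (u x) w" for u
    by (auto simp: eliminate_def fscale_def)
  show ?thesis
  proof
    assume "v \<in> fun_vs.span (insert w W)"
    then obtain a where "v - fscale a w \<in> fun_vs.span W"
      by (auto simp: fun_vs.span_breakdown_eq)
    then have "eliminate w x (v - fscale a w) \<in> fun_vs.span (eliminate w x ` W)"
      by (simp add: E.span_image)
    moreover have "eliminate w x w = 0" by (auto simp: eliminate_def)
    ultimately show "eliminate w x v \<in> fun_vs.span (eliminate w x ` W)"
      by (simp add: E.diff E.scale)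
  next
    assume *: "eliminate w x v \<in> fun_vs.span (eliminate w x ` W)"
    have "fun_vs.span (eliminate w x ` W) \<subseteq> fun_vs.span (insert w W)"
      unfolding E by (intro fun_vs.span_minimal)
        (auto intro!: fun_vs.span_diff fun_vs.span_scale intro: fun_vs.span_base)
    with * have "eliminate w x v + fscale (v x) w \<in> fun_vs.span (insert w W)"
      by (auto intro!: fun_vs.span_add fun_vs.span_scale intro: fun_vs.span_base)
    then have "fscale (inverse (w x)) (fscale (w x) v) \<in> fun_vs.span (insert w W)"
      by (intro fun_vs.span_scale[of "fscale (w x) v"]) (simp add: E)
    moreover have "fscale (inverse (w x)) (fscale (w x) v) = v" using assms by simp
    ultimately show "v \<in> fun_vs.span (insert w W)" by metis
  qed
qed

text \<open>Gaussian elimination can be carried out with ring operations alone, and its course depends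
  only on which entries vanish.\<close>

lemma span_same_kernel:
  fixes f :: "'r::comm_ring_1 \<Rightarrow> 'k::field" and g :: "'r \<Rightarrow> 'l::field"
  assumes f: "ring_map f" and g: "ring_map g" and ker: "\<And>p. f p = 0 \<longleftrightarrow> g p = 0"
  shows "(\<lambda>i. f (v i)) \<in> fun_vs.span ((\<lambda>w i. f (w i)) ` set ws) \<longleftrightarrow>
    (\<lambda>i. g (v i)) \<in> fun_vs.span ((\<lambda>w i. g (w i)) ` set ws)"
proof (induction "length ws" arbitrary: v ws)
  case 0
  then show ?case using ker by (simp add: fun_eq_iff)
next
  case (Suc n)
  then obtain w ws' where ws: "ws = w # ws'" "length ws' = n" by (cases ws) auto
  show ?case
  proof (cases "\<forall>i. f (w i) = 0")
    case True
    then have "(\<lambda>i. f (w i)) = 0" "(\<lambda>i. g (w i)) = 0" using ker by auto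
    then show ?thesis using Suc.hyps(1)[of ws'] ws by (simp add: fun_vs.span_insert_0)
  next
    case False
    \<comment> \<open>Equal kernels allow the same pivot position on both sides.\<close>
    then obtain x where x: "f (w x) \<noteq> 0" "g (w x) \<noteq> 0" using ker by blast
    have el: "eliminate (\<lambda>i. h (w i)) x (\<lambda>i. h (u i)) = (\<lambda>i. h (eliminate w x u i))"
      if "ring_map h" for u and h :: "'r \<Rightarrow> 's::field"
      using that by (auto simp: eliminate_def ring_map_diff) (auto simp: ring_map_def)
    have "(\<lambda>i. f (v i)) \<in> fun_vs.span ((\<lambda>w i. f (w i)) ` set ws) \<longleftrightarrow>
        (\<lambda>i. f (eliminate w x v i)) \<in>
          fun_vs.span ((\<lambda>w i. f (w i)) ` set (map (eliminate w x) ws'))"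
      using span_eliminate[of "\<lambda>i. f (w i)" x "\<lambda>i. f (v i)" "(\<lambda>w i. f (w i)) ` set ws'"] x
      by (simp add: ws el[OF f] image_image)
    moreover have "(\<lambda>i. g (v i)) \<in> fun_vs.span ((\<lambda>w i. g (w i)) ` set ws) \<longleftrightarrow>
        (\<lambda>i. g (eliminate w x v i)) \<in>
          fun_vs.span ((\<lambda>w i. g (w i)) ` set (map (eliminate w x) ws'))"
      using span_eliminate[of "\<lambda>i. g (w i)" x "\<lambda>i. g (v i)" "(\<lambda>w i. g (w i)) ` set ws'"] x
      by (simp add: ws el[OF g] image_image)
    ultimately show ?thesis using Suc.hyps(1)[of "map (eliminate w x) ws'"] ws by simp
  qed
qed

section \<open>Evaluation of integer polynomials\<close>

definition monomial :: "('i \<Rightarrow> 'r::comm_ring_1) \<Rightarrow> ('i \<Rightarrow>\<^sub>0 nat) \<Rightarrow> 'r"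
  where "monomial x m = (\<Prod>i\<in>Poly_Mapping.keys m. x i ^ Poly_Mapping.lookup m i)"

text \<open>Integer coefficients let one and the same polynomial be evaluated in two different
  fields.\<close>

definition int_eval :: "('i \<Rightarrow> 'r::comm_ring_1) \<Rightarrow> (('i \<Rightarrow>\<^sub>0 nat) \<Rightarrow>\<^sub>0 int) \<Rightarrow> 'r"
  where "int_eval x p = (\<Sum>m\<in>Poly_Mapping.keys p. of_int (Poly_Mapping.lookup p m) * monomial x m)"

lemma monomial_superset:
  "finite K \<Longrightarrow> Poly_Mapping.keys m \<subseteq> K \<Longrightarrow> monomial x m = (\<Prod>i\<in>K. x i ^ Poly_Mapping.lookup m i)"
  unfolding monomial_def by (rule prod.mono_neutral_left) (auto simp: in_keys_iff)

lemma monomial_add: "monomial x (m + m') = monomial x m * monomial x m'"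
proof -
  let ?K = "Poly_Mapping.keys m \<union> Poly_Mapping.keys m'"
  have "monomial x (m + m') = (\<Prod>i\<in>?K. x i ^ Poly_Mapping.lookup (m + m') i)"
    by (rule monomial_superset) (auto dest: subsetD[OF keys_add])
  also have "\<dots> = (\<Prod>i\<in>?K. x i ^ Poly_Mapping.lookup m i) * (\<Prod>i\<in>?K. x i ^ Poly_Mapping.lookup m' i)"
    by (simp add: lookup_add power_add prod.distrib)
  finally show ?thesis by (simp add: monomial_superset[of ?K])
qed

lemma int_eval_superset:
  "finite K \<Longrightarrow> Poly_Mapping.keys p \<subseteq> K \<Longrightarrow>
    int_eval x p = (\<Sum>m\<in>K. of_int (Poly_Mapping.lookup p m) * monomial x m)"
  unfolding int_eval_def by (rule sum.mono_neutral_left) (auto simp: in_keys_iff)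

lemma int_eval_add: "int_eval x (p + q) = int_eval x p + int_eval x q"
proof -
  let ?K = "Poly_Mapping.keys p \<union> Poly_Mapping.keys q"
  have "int_eval x (p + q) = (\<Sum>m\<in>?K. of_int (Poly_Mapping.lookup (p + q) m) * monomial x m)"
    by (rule int_eval_superset) (auto dest: subsetD[OF keys_add])
  also have "\<dots> = (\<Sum>m\<in>?K. of_int (Poly_Mapping.lookup p m) * monomial x m)
      + (\<Sum>m\<in>?K. of_int (Poly_Mapping.lookup q m) * monomial x m)"
    by (simp add: lookup_add algebra_simps sum.distrib)
  finally show ?thesis by (simp add: int_eval_superset[of ?K])
qed

lemma int_eval_zero: "int_eval x 0 = 0"
  and int_eval_single: "int_eval x (Poly_Mapping.single m c) = of_int c * monomial x m"
  by (simp_all add: int_eval_def)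

lemma int_eval_sum: "int_eval x (sum f A) = (\<Sum>a\<in>A. int_eval x (f a))"
  by (induction A rule: infinite_finite_induct) (simp_all add: int_eval_zero int_eval_add)

lemma poly_mapping_eq_sum_single:
  "p = (\<Sum>m\<in>Poly_Mapping.keys p. Poly_Mapping.single m (Poly_Mapping.lookup p m))"
  by (rule poly_mapping_eqI) (auto simp: lookup_sum lookup_single when_def in_keys_iff)

lemma int_eval_mult: "int_eval x (p * q) = int_eval x p * int_eval x q"
proof -
  have "p * q = (\<Sum>m\<in>Poly_Mapping.keys p. Poly_Mapping.single m (Poly_Mapping.lookup p m)) *
      (\<Sum>m'\<in>Poly_Mapping.keys q. Poly_Mapping.single m' (Poly_Mapping.lookup q m'))"
    by (intro arg_cong2[of _ _ _ _ "(*)"] poly_mapping_eq_sum_single)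
  also have "\<dots> = (\<Sum>m\<in>Poly_Mapping.keys p. \<Sum>m'\<in>Poly_Mapping.keys q.
      Poly_Mapping.single (m + m') (Poly_Mapping.lookup p m * Poly_Mapping.lookup q m'))"
    by (simp add: sum_product mult_single)
  finally have "int_eval x (p * q) = (\<Sum>m\<in>Poly_Mapping.keys p. \<Sum>m'\<in>Poly_Mapping.keys q.
      (of_int (Poly_Mapping.lookup p m) * monomial x m) * (of_int (Poly_Mapping.lookup q m') * monomial x m'))"
    by (simp add: int_eval_sum int_eval_single monomial_add ac_simps)
  then show ?thesis by (simp add: int_eval_def sum_product)
qed

lemma ring_map_int_eval: "ring_map (int_eval x)"
proof -
  have "int_eval x 1 = int_eval x (Poly_Mapping.single 0 1)" by simp
  also have "\<dots> = 1" unfolding int_eval_single by (simp add: monomial_def)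
  finally show ?thesis by (simp add: ring_map_def int_eval_zero int_eval_add int_eval_mult)
qed

lemma subfield_of_int: "is_subfield F \<Longrightarrow> of_int c \<in> F"
proof -
  assume F: "is_subfield F"
  then have "of_nat n \<in> F" for n by (induction n) (auto simp: is_subfield_def)
  then show "of_int c \<in> F" using F by (cases c rule: int_cases2) (auto simp: is_subfield_def)
qed

text \<open>Reduce the coefficients into the field and drop the monomials with a variable outside
  \<open>I\<close>, whose value is 0. The resulting \<open>q\<close> has the same value and
  coefficients in \<open>F\<close>, so independence makes the value vanish only if
  \<open>q = 0\<close>. The criterion on the right mentions neither the field nor the point
  \<open>x\<close>.\<close>

lemma int_eval_eq_0_iff:
  fixes x :: "'i \<Rightarrow> 'k::field"
  assumes "CHAR('k) = 2" "is_subfield F" "alg_indep_over F I x" "\<And>i. i \<notin> I \<Longrightarrow> x i = 0"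
  shows "int_eval x p = 0 \<longleftrightarrow> (\<forall>m. Poly_Mapping.keys m \<subseteq> I \<longrightarrow> even (Poly_Mapping.lookup p m))"
proof -
  define q where "q = Poly_Mapping.mapp (\<lambda>m c. if Poly_Mapping.keys m \<subseteq> I then of_int c :: 'k else 0) p"
  have q: "Poly_Mapping.lookup q m = (if Poly_Mapping.keys m \<subseteq> I then of_int (Poly_Mapping.lookup p m) else 0)" for m
    by (auto simp: q_def lookup_mapp when_def in_keys_iff)
  have keys_q: "Poly_Mapping.keys q \<subseteq> Poly_Mapping.keys p" by (auto simp: in_keys_iff q split: if_splits)
  have mon0: "monomial x m = 0" if m: "\<not> Poly_Mapping.keys m \<subseteq> I" for m
  proof -
    obtain i where "i \<in> Poly_Mapping.keys m" "i \<notin> I" using m by blast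
    then show ?thesis unfolding monomial_def using assms(4)
      by (intro prod_zero) (auto simp: in_keys_iff intro!: bexI[of _ i])
  qed
  have "mpoly_eval x q = (\<Sum>m\<in>Poly_Mapping.keys p. Poly_Mapping.lookup q m * monomial x m)"
    unfolding mpoly_eval_def monomial_def[symmetric]
    by (rule sum.mono_neutral_left[OF _ keys_q]) (auto simp: in_keys_iff)
  also have "\<dots> = int_eval x p"
    unfolding int_eval_def by (intro sum.cong) (auto simp: q mon0)
  finally have ev: "mpoly_eval x q = int_eval x p" .
  have "int_eval x p = 0 \<longleftrightarrow> q = 0"
  proof
    assume "int_eval x p = 0"
    then have "mpoly_eval x q = 0" by (simp add: ev)
    moreover have "Poly_Mapping.lookup q m \<in> F" for m
      using subfield_of_int[OF assms(2)] assms(2) by (auto simp: q is_subfield_def)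
    moreover have "Poly_Mapping.keys m \<subseteq> I" if "m \<in> Poly_Mapping.keys q" for m
      using that by (auto simp: in_keys_iff q split: if_splits)
    ultimately show "q = 0"
      by (intro assms(3)[unfolded alg_indep_over_def, rule_format]) auto
  next
    assume "q = 0"
    then show "int_eval x p = 0" using ev by (simp add: mpoly_eval_def)
  qed
  also have "\<dots> \<longleftrightarrow> (\<forall>m. Poly_Mapping.lookup q m = 0)" by (metis lookup_zero poly_mapping_eqI)
  also have "\<dots> \<longleftrightarrow> (\<forall>m. Poly_Mapping.keys m \<subseteq> I \<longrightarrow> even (Poly_Mapping.lookup p m))"
    by (auto simp: q of_int_eq_0_iff_char_dvd assms(1))
  finally show ?thesis .
qed

lemma alg_indep_over_permute:
  assumes indep: "alg_indep_over F I x" and inv: "\<And>i. s (s i) = i" and s: "s ` I \<subseteq> I"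
  shows "alg_indep_over F I (\<lambda>i. x (s i))"
  unfolding alg_indep_over_def
proof (intro allI impI, elim conjE)
  fix p assume p: "\<forall>m. Poly_Mapping.lookup p m \<in> F"
    "\<forall>m\<in>Poly_Mapping.keys p. Poly_Mapping.keys m \<subseteq> I" "mpoly_eval (\<lambda>i. x (s i)) p = 0"
  have inj_s: "inj s" by (metis inv injI)
  \<comment> \<open>Renaming of variables inside a monomial. As \<open>s\<close> is an involution,
    so is this renaming, and the same device applied to polynomials below gives
    \<open>q\<close>.\<close>
  define \<mu> :: "_ \<Rightarrow> (_ \<Rightarrow>\<^sub>0 nat)" where "\<mu> = Poly_Mapping.map_key s"
  have \<mu>: "Poly_Mapping.lookup (\<mu> m) i = Poly_Mapping.lookup m (s i)" for m i
    by (simp add: \<mu>_def Poly_Mapping.map_key.rep_eq[OF inj_s])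
  have \<mu>\<mu>: "\<mu> (\<mu> m) = m" for m by (rule poly_mapping_eqI) (simp add: \<mu> inv)
  have inj_\<mu>: "inj \<mu>" by (metis \<mu>\<mu> injI)
  define q where "q = Poly_Mapping.map_key \<mu> p"
  have q: "Poly_Mapping.lookup q m = Poly_Mapping.lookup p (\<mu> m)" for m
    by (simp add: q_def Poly_Mapping.map_key.rep_eq[OF inj_\<mu>])
  have keys_\<mu>: "Poly_Mapping.keys (\<mu> m) = s ` Poly_Mapping.keys m" for m
  proof (intro set_eqI iffI)
    fix i assume "i \<in> Poly_Mapping.keys (\<mu> m)"
    then have "s i \<in> Poly_Mapping.keys m" by (simp add: in_keys_iff \<mu>)
    then show "i \<in> s ` Poly_Mapping.keys m" by (metis inv imageI)
  qed (auto simp: in_keys_iff \<mu> inv)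
  have keys_q: "Poly_Mapping.keys q = \<mu> ` Poly_Mapping.keys p"
  proof (intro set_eqI iffI)
    fix m assume "m \<in> Poly_Mapping.keys q"
    then have "\<mu> m \<in> Poly_Mapping.keys p" by (simp add: in_keys_iff q)
    then show "m \<in> \<mu> ` Poly_Mapping.keys p" by (metis \<mu>\<mu> imageI)
  qed (auto simp: in_keys_iff q \<mu>\<mu>)
  have "mpoly_eval x q = (\<Sum>m\<in>Poly_Mapping.keys p. Poly_Mapping.lookup q (\<mu> m) * (\<Prod>i\<in>Poly_Mapping.keys (\<mu> m). x i ^ Poly_Mapping.lookup (\<mu> m) i))"
    unfolding mpoly_eval_def keys_q
    by (subst sum.reindex) (auto intro: inj_on_subset[OF inj_\<mu>])
  also have "\<dots> = mpoly_eval (\<lambda>i. x (s i)) p"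
    unfolding mpoly_eval_def
  proof (intro sum.cong refl)
    fix m
    have "(\<Prod>i\<in>Poly_Mapping.keys (\<mu> m). x i ^ Poly_Mapping.lookup (\<mu> m) i) = (\<Prod>i\<in>Poly_Mapping.keys m. x (s i) ^ Poly_Mapping.lookup m i)"
      unfolding keys_\<mu> by (subst prod.reindex) (auto simp: \<mu> inv intro: inj_on_subset[OF inj_s])
    then show "Poly_Mapping.lookup q (\<mu> m) * (\<Prod>i\<in>Poly_Mapping.keys (\<mu> m). x i ^ Poly_Mapping.lookup (\<mu> m) i) =
        Poly_Mapping.lookup p m * (\<Prod>i\<in>Poly_Mapping.keys m. x (s i) ^ Poly_Mapping.lookup m i)" by (simp add: q \<mu>\<mu>)
  qed
  finally have "mpoly_eval x q = 0" using p(3) by simp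
  moreover have "Poly_Mapping.keys m \<subseteq> I" if "m \<in> Poly_Mapping.keys q" for m
    using that p(2) s by (fastforce simp: keys_q keys_\<mu>)
  moreover have "Poly_Mapping.lookup q m \<in> F" for m using p(1) by (simp add: q)
  ultimately have "q = 0"
    by (intro indep[unfolded alg_indep_over_def, rule_format]) auto
  show "p = 0"
  proof (rule poly_mapping_eqI)
    fix m
    have "Poly_Mapping.lookup p m = Poly_Mapping.lookup q (\<mu> m)" by (simp add: q \<mu>\<mu>)
    then show "Poly_Mapping.lookup p m = Poly_Mapping.lookup 0 m" using \<open>q = 0\<close> by simp
  qed
qed

section \<open>Independence of the generic basis\<close>

text \<open>The part of genericity from which spans are compared; in this form it passes easily to a
  family with two vectors exchanged.\<close>

definition generic_vectors :: "'a set \<Rightarrow> nat \<Rightarrow> (nat \<Rightarrow> 'a \<Rightarrow> 'k::field) \<Rightarrow> bool"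
  where "generic_vectors A n b \<longleftrightarrow> (\<forall>j\<in>{1..n}. b j \<in> vec_space A) \<and>
    (\<exists>F. is_subfield F \<and> alg_indep_over F (A \<times> {1..n}) (\<lambda>(u, j). b j u))"

lemma generic_basis_imp_vectors:
  assumes "generic_basis A b"
  shows "generic_vectors A (card A) b"
proof -
  have "b ` {1..card A} \<subseteq> vec_space A"
    using assms fun_vs.span_superset[of "b ` {1..card A}"]
    by (simp add: generic_basis_def ordered_basis_def)
  then show ?thesis using assms unfolding generic_basis_def generic_vectors_def by blast
qed

lemma vprod_ring_map:
  assumes "ring_map f"
  shows "f (vprod vs U) = vprod (map (\<lambda>v u. f (v u)) vs) U"
proof (induction vs arbitrary: U)
  case Nil
  then show ?case using assms by (simp add: vprod_Nil std_def ring_map_def)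
next
  case (Cons v vs)
  have "f (x * y) = f x * f y" for x y using assms by (simp add: ring_map_def)
  then show ?case by (simp add: vprod_Cons vmul_def ring_map_sum[OF assms] Cons)
qed

lemma phi_bprod_ring_map:
  assumes "ring_map f"
  shows "f (phi r (bprod b S) x) = phi r (bprod (\<lambda>j u. f (b j u)) S) x"
  by (simp add: phi_def bprod_def ring_map_sum[OF assms] vprod_ring_map[OF assms] comp_def)

lemma bprod_cong:
  assumes "S \<subseteq> {1..n}" "\<And>j. j \<in> {1..n} \<Longrightarrow> b j = b' j"
  shows "bprod b S = bprod b' S"
proof -
  have "finite S" using assms(1) finite_subset by blast
  then show ?thesis unfolding bprod_def using assms by (intro arg_cong[of _ _ vprod] map_cong) auto
qed

text \<open>Both families arise from one matrix \<open>G\<close> of indeterminates, by evaluation at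
  \<open>x\<close> and at \<open>x'\<close>. The two evaluations have the same kernel, so
  \<open>span_same_kernel\<close> applies.\<close>

lemma generic_span_iff:
  fixes b :: "nat \<Rightarrow> 'a::{finite,order_bot} \<Rightarrow> 'k::field" and b' :: "nat \<Rightarrow> 'a \<Rightarrow> 'l::field"
  assumes k: "CHAR('k) = 2" and l: "CHAR('l) = 2"
    and b: "generic_vectors A n b" and b': "generic_vectors A n b'"
    and S: "S \<subseteq> {1..n}" and X: "X \<subseteq> Pow {1..n}"
  shows "phi r (bprod b S) \<in> fun_vs.span ((\<lambda>T. phi r (bprod b T)) ` X) \<longleftrightarrow>
    phi r (bprod b' S) \<in> fun_vs.span ((\<lambda>T. phi r (bprod b' T)) ` X)"
proof -
  \<comment> \<open>The value 0 outside the index set is what \<open>int_eval_eq_0_iff\<close> asks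
    for; on the vectors with index in \<open>{1..n}\<close> nothing changes, as they vanish outside
    \<open>A\<close>.\<close>
  define x where "x = (\<lambda>(u, j). if u \<in> A \<and> j \<in> {1..n} then b j u else 0)"
  define x' where "x' = (\<lambda>(u, j). if u \<in> A \<and> j \<in> {1..n} then b' j u else 0)"
  define G :: "nat \<Rightarrow> 'a \<Rightarrow> (('a \<times> nat) \<Rightarrow>\<^sub>0 nat) \<Rightarrow>\<^sub>0 int"
    where "G j u = Poly_Mapping.single (Poly_Mapping.single (u, j) 1) 1" for j u
  have cong: "alg_indep_over F I y" if z: "alg_indep_over F I z" and eq: "\<And>i. i \<in> I \<Longrightarrow> y i = z i"
    for F I and y z :: "'i \<Rightarrow> 'm::field"
  proof -
    have "mpoly_eval y p = mpoly_eval z p" if "\<forall>m\<in>Poly_Mapping.keys p. Poly_Mapping.keys m \<subseteq> I" for p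
      unfolding mpoly_eval_def
    proof (intro sum.cong refl arg_cong2[of _ _ _ _ "(*)"] prod.cong)
      fix m i assume "m \<in> Poly_Mapping.keys p" "i \<in> Poly_Mapping.keys m"
      then have "i \<in> I" using that by blast
      then show "y i ^ Poly_Mapping.lookup m i = z i ^ Poly_Mapping.lookup m i" using eq by simp
    qed
    then show ?thesis using z unfolding alg_indep_over_def by metis
  qed
  have "int_eval x p = 0 \<longleftrightarrow> (\<forall>m. Poly_Mapping.keys m \<subseteq> A \<times> {1..n} \<longrightarrow> even (Poly_Mapping.lookup p m))" for p
  proof -
    obtain F where F: "is_subfield F" "alg_indep_over F (A \<times> {1..n}) (\<lambda>(u, j). b j u)"
      using b by (auto simp: generic_vectors_def)
    from F(2) have "alg_indep_over F (A \<times> {1..n}) x" by (rule cong) (auto simp: x_def)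
    then show ?thesis by (rule int_eval_eq_0_iff[OF k F(1)]) (auto simp: x_def split: if_splits)
  qed
  moreover have "int_eval x' p = 0 \<longleftrightarrow> (\<forall>m. Poly_Mapping.keys m \<subseteq> A \<times> {1..n} \<longrightarrow> even (Poly_Mapping.lookup p m))" for p
  proof -
    obtain F where F: "is_subfield F" "alg_indep_over F (A \<times> {1..n}) (\<lambda>(u, j). b' j u)"
      using b' by (auto simp: generic_vectors_def)
    from F(2) have "alg_indep_over F (A \<times> {1..n}) x'" by (rule cong) (auto simp: x'_def)
    then show ?thesis by (rule int_eval_eq_0_iff[OF l F(1)]) (auto simp: x'_def split: if_splits)
  qed
  ultimately have ker: "int_eval x p = 0 \<longleftrightarrow> int_eval x' p = 0" for p by blast
  have G: "int_eval y (G j u) = y (u, j)" for y :: "_ \<Rightarrow> 'm::field" and j u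
    by (simp add: G_def int_eval_single monomial_def)
  have "phi r (bprod b T) = (\<lambda>i. int_eval x (phi r (bprod G T) i))" if "T \<subseteq> {1..n}" for T
  proof -
    have "bprod b T = bprod (\<lambda>j u. int_eval x (G j u)) T"
      by (rule bprod_cong[OF that]) (use b in \<open>force simp: G x_def generic_vectors_def vec_space_def\<close>)
    then show ?thesis by (simp add: phi_bprod_ring_map[OF ring_map_int_eval])
  qed
  note im = this
  have "phi r (bprod b' T) = (\<lambda>i. int_eval x' (phi r (bprod G T) i))" if "T \<subseteq> {1..n}" for T
  proof -
    have "bprod b' T = bprod (\<lambda>j u. int_eval x' (G j u)) T"
      by (rule bprod_cong[OF that]) (use b' in \<open>force simp: G x'_def generic_vectors_def vec_space_def\<close>)
    then show ?thesis by (simp add: phi_bprod_ring_map[OF ring_map_int_eval])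
  qed
  note im' = this
  have "finite X" using X finite_subset by blast
  then obtain Ts where Ts: "set Ts = X" using finite_list by blast
  let ?ws = "map (\<lambda>T. phi r (bprod G T)) Ts"
  have "(\<lambda>T. phi r (bprod b T)) ` X = (\<lambda>w i. int_eval x (w i)) ` set ?ws"
    "(\<lambda>T. phi r (bprod b' T)) ` X = (\<lambda>w i. int_eval x' (w i)) ` set ?ws"
    unfolding set_map image_image Ts
    by (intro image_cong refl im im'; use X in blast)+
  then show ?thesis
    using span_same_kernel[OF ring_map_int_eval ring_map_int_eval ker, of "phi r (bprod G S)" ?ws]
    by (simp only: im[OF S] im'[OF S])
qed

lemma shifting_independent:
  fixes b :: "nat \<Rightarrow> 'a::{finite,order_bot} \<Rightarrow> 'k::field" and b' :: "nat \<Rightarrow> 'a \<Rightarrow> 'l::field"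
  assumes "CHAR('k) = 2" "CHAR('l) = 2" "generic_vectors A n b" "generic_vectors A n b'"
  shows "shifting r n b = shifting r n b'"
proof -
  have "lex_below n S \<subseteq> Pow {1..n}" for S by (auto simp: lex_below_def)
  then show ?thesis
    unfolding shifting_def
    by (intro Collect_cong conj_cong refl arg_cong[of _ _ Not] generic_span_iff[OF assms])
qed

section \<open>Shiftedness\<close>

lemma generic_vectors_transpose:
  assumes "generic_vectors A n b" "i \<in> {1..n}" "j \<in> {1..n}"
  shows "generic_vectors A n (\<lambda>l. b (transpose i j l))"
proof -
  let ?t = "\<lambda>(u, l). (u, transpose i j l)"
  have t: "transpose i j l \<in> {1..n}" if "l \<in> {1..n}" for l
    using that assms(2,3) by (auto simp: transpose_def)
  obtain F where F: "is_subfield F" "alg_indep_over F (A \<times> {1..n}) (\<lambda>(u, j). b j u)"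
    using assms(1) by (auto simp: generic_vectors_def)
  have "alg_indep_over F (A \<times> {1..n}) (\<lambda>p. (\<lambda>(u, j). b j u) (?t p))"
    by (rule alg_indep_over_permute[OF F(2)]) (use t in auto)
  then show ?thesis
    using assms(1) t F(1) unfolding generic_vectors_def by (auto simp: case_prod_unfold)
qed

lemma bprod_inj:
  fixes b :: "nat \<Rightarrow> 'a::finite \<Rightarrow> 'r::comm_ring_1"
  assumes "inj s" "finite S"
  shows "bprod (\<lambda>l. b (s l)) S = bprod b (s ` S)"
  using assms(2)
proof (induction S rule: finite_induct)
  case empty
  then show ?case by (simp add: bprod_def)
next
  case (insert x F)
  then show ?case using assms(1) by (simp add: bprod_insert inj_image_mem_iff)
qed

text \<open>Let \<open>m\<close> be the first difference of \<open>T\<close> and the image of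
  \<open>S\<close>. If \<open>j\<close> lies in \<open>T\<close> and \<open>m > i\<close>, then
  \<open>i\<close> is the first difference after transposing. Otherwise \<open>m\<close> is neither
  \<open>i\<close> nor \<open>j\<close>, and it stays the first difference.\<close>

lemma lex_below_transpose:
  assumes "i < j" "i \<in> {1..n}" "j \<in> {1..n}" "i \<notin> S" "j \<in> S" "S \<subseteq> {1..n}"
    and T: "T \<in> lex_below n (transpose i j ` S)"
  shows "transpose i j ` T \<in> lex_below n S"
proof -
  let ?t = "transpose i j"
  have T': "T \<subseteq> {1..n}" "card T = card S" "lex_less T (?t ` S)"
    using T by (auto simp: lex_below_def card_image)
  have fin: "finite S" "finite T" using assms(6) T'(1) finite_subset by blast+
  obtain m where m: "m \<in> T" "m \<notin> ?t ` S" "\<forall>k<m. k \<in> T \<longleftrightarrow> k \<in> ?t ` S"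
    using T'(3) fin by (auto simp: lex_less_iff)
  have "lex_less (?t ` T) S"
  proof (cases "m > i \<and> j \<in> T")
    case True
    then have "i \<in> ?t ` T" "\<forall>k<i. k \<in> ?t ` T \<longleftrightarrow> k \<in> S"
      using m assms(1) by (auto simp: in_transpose_image_iff)
    then have "\<exists>m. m \<in> ?t ` T \<and> m \<notin> S \<and> (\<forall>k<m. k \<in> ?t ` T \<longleftrightarrow> k \<in> S)"
      using assms(4) by blast
    then show ?thesis using fin by (simp add: lex_less_iff)
  next
    case False
    have "m \<noteq> i" using m(2) assms(5) by (auto simp: in_transpose_image_iff)
    moreover have "m \<noteq> j" using False m(1) assms(1) by auto
    ultimately have t: "?t m = m" by simp
    have "k \<in> ?t ` T \<longleftrightarrow> k \<in> S" if "k < m" for k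
    proof -
      consider "k = i" | "k = j" | "k \<noteq> i" "k \<noteq> j" by blast
      then show ?thesis
      proof cases
        case 1
        then have "j \<notin> T" using False that by simp
        then show ?thesis using 1 assms(4) by (simp add: in_transpose_image_iff)
      next
        case 2
        then have "i < m" using that assms(1) by simp
        then have "i \<in> T" using m(3) assms(5) by (simp add: in_transpose_image_iff)
        then show ?thesis using 2 assms(5) by (simp add: in_transpose_image_iff)
      next
        case 3
        then show ?thesis using m(3) that by (simp add: in_transpose_image_iff)
      qed
    qed
    moreover have "m \<in> ?t ` T" "m \<notin> S" using m(1,2) t by (auto simp: in_transpose_image_iff)
    ultimately have "\<exists>m. m \<in> ?t ` T \<and> m \<notin> S \<and> (\<forall>k<m. k \<in> ?t ` T \<longleftrightarrow> k \<in> S)"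
      by blast
    then show ?thesis using fin by (simp add: lex_less_iff)
  qed
  moreover have "?t ` T \<subseteq> {1..n}" using T'(1) assms(2,3) by (auto simp: transpose_def)
  ultimately show ?thesis using T'(2) by (simp add: lex_below_def card_image)
qed

text \<open>Suppose the product for the exchanged set lies in the span of its predecessors. By
  genericity the same holds with \<open>b i\<close> and \<open>b j\<close> swapped, which puts
  \<open>b_S\<close> in the span of products that precede \<open>S\<close> by
  \<open>lex_below_transpose\<close>, a contradiction.\<close>

lemma shifting_exchange:
  fixes b :: "nat \<Rightarrow> 'a::{finite,order_bot} \<Rightarrow> 'k::field"
  assumes k: "CHAR('k) = 2" and b: "generic_vectors A n b"
    and S: "S \<in> shifting r n b" and ij: "1 \<le> i" "i < j" "i \<notin> S" "j \<in> S"
  shows "insert i (S - {j}) \<in> shifting r n b"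
proof (rule ccontr)
  let ?t = "transpose i j"
  assume not: "insert i (S - {j}) \<notin> shifting r n b"
  have sub: "S \<subseteq> {1..n}" using S by (simp add: shifting_def)
  then have ijn: "i \<in> {1..n}" "j \<in> {1..n}" using ij by auto
  have fin: "finite S" using sub finite_subset by blast
  have tS: "insert i (S - {j}) = ?t ` S" using ij by (auto simp: in_transpose_image_iff transpose_def)
  have sub': "?t ` S \<subseteq> {1..n}" using sub ijn by (auto simp: transpose_def)
  have X: "lex_below n (?t ` S) \<subseteq> Pow {1..n}" by (auto simp: lex_below_def)
  have "phi r (bprod b (?t ` S)) \<in> fun_vs.span ((\<lambda>T. phi r (bprod b T)) ` lex_below n (?t ` S))"
    using not sub' by (simp add: shifting_def tS)
  then have "phi r (bprod (\<lambda>l. b (?t l)) (?t ` S)) \<in>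
      fun_vs.span ((\<lambda>T. phi r (bprod (\<lambda>l. b (?t l)) T)) ` lex_below n (?t ` S))"
    using generic_span_iff[OF k k b generic_vectors_transpose[OF b ijn] sub' X] by blast
  moreover have "bprod (\<lambda>l. b (?t l)) T = bprod b (?t ` T)" if "T \<subseteq> {1..n}" for T
    using that finite_subset by (intro bprod_inj inj_transpose) auto
  ultimately have "phi r (bprod b S) \<in>
      fun_vs.span ((\<lambda>T. phi r (bprod b (?t ` T))) ` lex_below n (?t ` S))"
    using sub' X by (simp add: image_image subset_iff cong: image_cong_simp)
  moreover have "(\<lambda>T. phi r (bprod b (?t ` T))) ` lex_below n (?t ` S)
      \<subseteq> (\<lambda>T. phi r (bprod b T)) ` lex_below n S"
    using lex_below_transpose[OF ij(2) ijn ij(3,4) sub] by auto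
  ultimately have "phi r (bprod b S) \<in> fun_vs.span ((\<lambda>T. phi r (bprod b T)) ` lex_below n S)"
    using fun_vs.span_mono by blast
  then show False using S by (simp add: shifting_def)
qed

text \<open>The elements of \<open>S\<close> are replaced by those of \<open>T\<close> one at a
  time, beginning with the smallest.\<close>

lemma shifted_if_exchange:
  assumes sub: "\<And>S. S \<in> K \<Longrightarrow> finite S \<and> S \<subseteq> {1..}"
    and ex: "\<And>S i j. S \<in> K \<Longrightarrow> 1 \<le> i \<Longrightarrow> i < j \<Longrightarrow> i \<notin> S \<Longrightarrow> j \<in> S \<Longrightarrow> insert i (S - {j}) \<in> K"
  shows "shifted K"
  unfolding shifted_def
proof (intro conjI ballI allI impI)
  fix S T assume S: "S \<in> K"
    and T: "finite T \<and> T \<subseteq> {1..} \<and> list_all2 (\<le>) (sorted_list_of_set T) (sorted_list_of_set S)"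
  define ss where "ss = sorted_list_of_set S"
  define ts where "ts = sorted_list_of_set T"
  have len: "length ts = length ss" and le: "\<And>m. m < length ss \<Longrightarrow> ts ! m \<le> ss ! m"
    using T by (auto simp: list_all2_conv_all_nth ss_def ts_def)
  have sets: "set ss = S" "set ts = T" using S sub T by (auto simp: ss_def ts_def)
  have strict: "sorted_wrt (<) ss" "sorted_wrt (<) ts" by (simp_all add: ss_def ts_def)
  \<comment> \<open>The list stays strictly increasing because \<open>ts ! m <= ss ! m\<close>; each
    step is therefore an admissible exchange or no change at all.\<close>
  have "set (take m ts @ drop m ss) \<in> K" if "m \<le> length ss" for m
    using that
  proof (induction m)
    case 0
    then show ?case using S sets by simp
  next
    case (Suc m)
    let ?i = "ts ! m" and ?j = "ss ! m"
    have m: "m < length ss" "m < length ts" using Suc.prems len by auto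
    have old: "set (take m ts @ drop m ss) = insert ?j (set (take m ts) \<union> set (drop (Suc m) ss))"
      using m by (simp flip: Cons_nth_drop_Suc)
    have new: "set (take (Suc m) ts @ drop (Suc m) ss)
        = insert ?i (set (take m ts) \<union> set (drop (Suc m) ss))"
      using m by (simp add: take_Suc_conv_app_nth)
    have IH: "insert ?j (set (take m ts) \<union> set (drop (Suc m) ss)) \<in> K"
      using Suc.IH m old by simp
    have lt: "x < ?i" if "x \<in> set (take m ts)" for x
      using that strict(2) m by (auto simp: in_set_conv_nth sorted_wrt_nth_less)
    have gt: "?j < x" if "x \<in> set (drop (Suc m) ss)" for x
      using that strict(1) m by (auto simp: in_set_conv_nth sorted_wrt_nth_less)
    show ?case
    proof (cases "?i = ?j")
      case True
      then show ?thesis using IH new by simp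
    next
      case False
      then have ij: "?i < ?j" using le m by (simp add: le_neq_implies_less)
      have "?i \<in> T" using m sets by auto
      then have "1 \<le> ?i" using T by auto
      have "?i \<notin> insert ?j (set (take m ts) \<union> set (drop (Suc m) ss))"
        using lt gt ij by fastforce
      then have "insert ?i (insert ?j (set (take m ts) \<union> set (drop (Suc m) ss)) - {?j}) \<in> K"
        using ex[OF IH \<open>1 \<le> ?i\<close> ij] by simp
      moreover have "insert ?j (set (take m ts) \<union> set (drop (Suc m) ss)) - {?j}
          = set (take m ts) \<union> set (drop (Suc m) ss)"
        using lt gt ij by fastforce
      ultimately show ?thesis using new by simp
    qed
  qed
  from this[of "length ss"] show "T \<in> K" using len sets by simp
qed (use sub in auto)

lemma shifted_shifting:
  fixes b :: "nat \<Rightarrow> 'a::{finite,order_bot} \<Rightarrow> 'k::field"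
  assumes "CHAR('k) = 2" "generic_vectors A n b"
  shows "shifted (shifting r n b)"
proof (rule shifted_if_exchange)
  show "finite S \<and> S \<subseteq> {1..}" if "S \<in> shifting r n b" for S
    using that by (auto simp: shifting_def dest: finite_subset)
qed (rule shifting_exchange[OF assms])

section \<open>The face numbers\<close>

text \<open>Induction that removes the greatest index \<open>m\<close>: the predecessors of every
  other index are unaffected, and the predecessors of \<open>m\<close> are all the rest. So
  \<open>m\<close> is picked exactly if it enlarges the span.\<close>

lemma greedy_basis:
  fixes v :: "'j \<Rightarrow> 'i \<Rightarrow> 'k::field" and R :: "'j \<Rightarrow> 'j \<Rightarrow> bool"
  assumes "finite J" "transp_on J R" "asymp_on J R" "totalp_on J R"
    and G: "G = {k \<in> J. v k \<notin> fun_vs.span (v ` {l \<in> J. R l k})}"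
  shows "inj_on v G \<and> fun_vs.independent (v ` G) \<and> fun_vs.span (v ` G) = fun_vs.span (v ` J)"
  using assms
proof (induction "card J" arbitrary: J G)
  case 0
  then show ?case by (simp add: fun_vs.independent_empty)
next
  case (Suc c)
  then have "J \<noteq> {}" by auto
  obtain m where m: "m \<in> J" "\<forall>x\<in>J. x \<noteq> m \<longrightarrow> \<not> R m x"
    using Finite_Set.bex_max_element[OF Suc.prems(1,3,2) \<open>J \<noteq> {}\<close>] by blast
  define J' where "J' = J - {m}"
  define G' where "G' = {k \<in> J'. v k \<notin> fun_vs.span (v ` {l \<in> J'. R l k})}"
  have J: "J = insert m J'" "m \<notin> J'" using m by (auto simp: J'_def)
  have on: "transp_on J' R" "asymp_on J' R" "totalp_on J' R"
    using Suc.prems(2-4) by (auto simp: J'_def intro: transp_on_subset asymp_on_subset totalp_on_subset)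
  have "c = card J'" using Suc.hyps(2) Suc.prems(1) m(1) by (simp add: J'_def)
  moreover have "finite J'" using Suc.prems(1) by (simp add: J'_def)
  ultimately have IH: "inj_on v G'" "fun_vs.independent (v ` G')"
      "fun_vs.span (v ` G') = fun_vs.span (v ` J')"
    using Suc.hyps(1)[OF _ _ on G'_def] by auto
  have "{l \<in> J. R l k} = {l \<in> J'. R l k}" if "k \<in> J'" for k
    using m(2) that J by auto
  moreover have "\<not> R m m" using m(1) Suc.prems(3) by (auto simp: asymp_on_def)
  then have "{l \<in> J. R l m} = J'"
    using J m Suc.prems(4) unfolding totalp_on_def by fastforce
  ultimately have G: "G = G' \<union> (if v m \<in> fun_vs.span (v ` J') then {} else {m})"
    unfolding Suc.prems(5) G'_def using J by auto
  have img: "v ` J = insert (v m) (v ` J')" using J by simp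
  show ?case
  proof (cases "v m \<in> fun_vs.span (v ` J')")
    case True
    then show ?thesis using IH G img by (simp add: fun_vs.span_redundant)
  next
    case False
    then have G: "G = insert m G'" using G by simp
    have "v m \<notin> v ` G'" using False IH(3) fun_vs.span_base by blast
    moreover have "m \<notin> G'" using J by (simp add: G'_def)
    ultimately have "inj_on v G" using IH(1) G by simp
    moreover have "fun_vs.independent (v ` G)"
      using False IH unfolding G by (simp add: fun_vs.independent_insertI)
    moreover have "fun_vs.span (v ` G) = fun_vs.span (v ` J)"
    proof -
      have "x \<in> fun_vs.span (insert a A) \<longleftrightarrow> x \<in> fun_vs.span (insert a B)"
        if "fun_vs.span A = fun_vs.span B" for x a and A B :: "('i \<Rightarrow> 'k) set"
        using that by (simp add: fun_vs.span_breakdown_eq)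
      then show ?thesis using IH(3) unfolding G img image_insert by blast
    qed
    ultimately show ?thesis by blast
  qed
qed

text \<open>A product of \<open>d\<close> vectors is homogeneous of degree \<open>d\<close>.\<close>

lemma card_support_vprod:
  assumes "vprod vs U \<noteq> 0" "finite U"
  shows "card U = length vs"
  using assms
proof (induction vs arbitrary: U)
  case Nil
  then show ?case by (simp add: vprod_Nil std_def split: if_splits)
next
  case (Cons v vs)
  then obtain u where u: "u \<in> U" "v u * vprod vs (U - {u}) \<noteq> 0"
    unfolding vprod_Cons vmul_def by (meson sum.not_neutral_contains_not_neutral)
  then have "vprod vs (U - {u}) \<noteq> 0" by auto
  then have "card (U - {u}) = length vs" using Cons by simp
  then show ?case using u(1) Cons.prems(2) card_Suc_Diff1 by fastforce
qed

lemma rank_support_phi_bprod: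
  assumes "phi r (bprod b S) x \<noteq> 0" "finite S"
  shows "r x = card S"
proof -
  obtain U where U: "U \<in> bases r x" "bprod b S U \<noteq> 0"
    using assms(1) unfolding phi_def by (meson sum.not_neutral_contains_not_neutral)
  then have "card U = card S"
    using card_support_vprod[of "map b (sorted_list_of_set S)" U] assms(2) by (simp add: bprod_def)
  then show ?thesis using U(1) by (simp add: bases_def)
qed

lemma module_hom_vmul_left: "module_hom fscale fscale (\<lambda>v. vmul v w)"
  by unfold_locales
    (auto simp: vmul_def fscale_def fun_eq_iff algebra_simps sum.distrib sum_distrib_left)

section \<open>The part of rank \<open>d\<close> and its two bases\<close>

definition subsets_of_card :: "nat \<Rightarrow> nat \<Rightarrow> nat set set"
  where "subsets_of_card n d = {S. S \<subseteq> {1..n} \<and> card S = d}"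

lemma finite_in_subsets_of_card: "S \<in> subsets_of_card n d \<Longrightarrow> finite S"
  by (auto simp: subsets_of_card_def intro: finite_subset)

text \<open>By linearity in both factors it suffices to multiply \<open>b_S\<close> by
  \<open>b_j\<close>, which gives 0 or the product for \<open>insert j S\<close>.\<close>

lemma vmul_in_span_bprod:
  fixes b :: "nat \<Rightarrow> 'a::finite \<Rightarrow> 'k::field"
  assumes k: "CHAR('k) = 2" and v: "v \<in> fun_vs.span (b ` {1..n})"
    and w: "w \<in> fun_vs.span (bprod b ` subsets_of_card n d)"
  shows "vmul v w \<in> fun_vs.span (bprod b ` subsets_of_card n (Suc d))" (is "_ \<in> ?X")
proof -
  interpret L: module_hom fscale fscale "\<lambda>v. vmul v w" by (rule module_hom_vmul_left)
  have "vmul (b j) w \<in> ?X" if j: "j \<in> {1..n}" for j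
  proof -
    interpret R: module_hom fscale fscale "vmul (b j)" by (rule module_hom_vmul)
    have "vmul (b j) (bprod b S) \<in> ?X" if S: "S \<in> subsets_of_card n d" for S
    proof (cases "j \<in> S")
      case True
      then have "vmul (b j) (bprod b S) = 0"
        by (rule vmul_bprod_mem[OF k finite_in_subsets_of_card[OF S]])
      then show ?thesis by (simp add: fun_vs.span_zero)
    next
      case False
      have "insert j S \<in> subsets_of_card n (Suc d)"
        using S j False finite_in_subsets_of_card[OF S] by (simp add: subsets_of_card_def)
      then show ?thesis
        using bprod_insert[OF finite_in_subsets_of_card[OF S] False, of b, symmetric]
        by (simp add: fun_vs.span_base)
    qed
    then have "fun_vs.span (vmul (b j) ` bprod b ` subsets_of_card n d) \<subseteq> ?X"
      by (intro fun_vs.span_minimal) auto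
    then show ?thesis using w R.span_image by blast
  qed
  then have "fun_vs.span ((\<lambda>v. vmul v w) ` b ` {1..n}) \<subseteq> ?X"
    by (intro fun_vs.span_minimal) auto
  then show ?thesis using v L.span_image by blast
qed

lemma vprod_in_span_bprod:
  fixes b :: "nat \<Rightarrow> 'a::finite \<Rightarrow> 'k::field"
  assumes k: "CHAR('k) = 2" and "\<And>v. v \<in> set vs \<Longrightarrow> v \<in> fun_vs.span (b ` {1..n})"
  shows "vprod vs \<in> fun_vs.span (bprod b ` subsets_of_card n (length vs))"
  using assms(2)
proof (induction vs)
  case Nil
  have "{} \<in> subsets_of_card n 0" by (simp add: subsets_of_card_def)
  moreover have "vprod [] = bprod b {}" by (simp add: bprod_def)
  ultimately show ?case by (simp add: fun_vs.span_base)
next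
  case (Cons v vs)
  then show ?case by (simp add: vprod_Cons vmul_in_span_bprod[OF k])
qed

lemma in_span_unit_vec:
  fixes f :: "'a::finite \<Rightarrow> 'k::field"
  assumes "\<And>x. f x \<noteq> 0 \<Longrightarrow> x \<in> R"
  shows "f \<in> fun_vs.span (unit_vec ` R)"
proof -
  have "f = (\<Sum>x\<in>R. fscale (f x) (unit_vec x))"
  proof
    fix y
    have "(\<Sum>x\<in>R. f x * unit_vec x y) = (\<Sum>x\<in>R. if x = y then f y else 0)"
      by (intro sum.cong) (auto simp: unit_vec_def)
    then show "f y = (\<Sum>x\<in>R. fscale (f x) (unit_vec x)) y"
      using assms[of y] by (auto simp: sum_apply fscale_def)
  qed
  also have "\<dots> \<in> fun_vs.span (unit_vec ` R)"
    by (intro fun_vs.span_sum fun_vs.span_scale fun_vs.span_base imageI)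
  finally show ?thesis .
qed

lemma inj_unit_vec: "inj (unit_vec :: 'a \<Rightarrow> 'a \<Rightarrow> 'k::field)"
proof (rule injI)
  fix x y :: 'a assume "(unit_vec x :: 'a \<Rightarrow> 'k) = unit_vec y"
  then have "(unit_vec x y :: 'k) = unit_vec y y" by simp
  then show "x = y" by (simp add: unit_vec_def split: if_splits)
qed

lemma independent_unit_vec:
  "fun_vs.independent (unit_vec ` R :: ('a \<Rightarrow> 'k::field) set)"
  unfolding fun_vs.dependent_def
proof
  assume "\<exists>a\<in>unit_vec ` R. (a :: 'a \<Rightarrow> 'k) \<in> fun_vs.span (unit_vec ` R - {a})"
  then obtain x where x: "(unit_vec x :: 'a \<Rightarrow> 'k) \<in> fun_vs.span (unit_vec ` R - {unit_vec x})"
    by blast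
  have "fun_vs.subspace {f :: 'a \<Rightarrow> 'k. f x = 0}"
    by (simp add: fun_vs.subspace_def fscale_def)
  moreover have "unit_vec ` R - {unit_vec x} \<subseteq> {f :: 'a \<Rightarrow> 'k. f x = 0}"
    by (auto simp: unit_vec_def)
  ultimately have "fun_vs.span (unit_vec ` R - {unit_vec x}) \<subseteq> {f :: 'a \<Rightarrow> 'k. f x = 0}"
    by (intro fun_vs.span_minimal)
  then have "(unit_vec x :: 'a \<Rightarrow> 'k) x = 0" using x by blast
  then show False by (simp add: unit_vec_def)
qed

text \<open>One inclusion is homogeneity. For the other, the unit vector at \<open>x\<close> is the
  image of \<open>e_U\<close> for a basis \<open>U\<close> of \<open>x\<close>, and
  \<open>e_U\<close> is a product of \<open>d\<close> vectors from the span of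
  \<open>b\<close>.\<close>

lemma (in geometric_lattice) span_phi_bprod:
  fixes b :: "nat \<Rightarrow> 'a \<Rightarrow> 'k::field"
  assumes k: "CHAR('k) = 2" and b: "fun_vs.span (b ` {1..n}) = vec_space atoms"
  shows "fun_vs.span ((\<lambda>S. phi r (bprod b S)) ` subsets_of_card n d) =
    fun_vs.span (unit_vec ` {x. r x = d})"
proof (rule antisym)
  interpret P: module_hom fscale fscale "phi r :: ('a set \<Rightarrow> 'k) \<Rightarrow> _" by (rule module_hom_phi)
  have "phi r (bprod b S) \<in> fun_vs.span (unit_vec ` {x. r x = d})"
    if S: "S \<in> subsets_of_card n d" for S
    using rank_support_phi_bprod[OF _ finite_in_subsets_of_card[OF S]] S
    by (intro in_span_unit_vec) (simp add: subsets_of_card_def)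
  then show "fun_vs.span ((\<lambda>S. phi r (bprod b S)) ` subsets_of_card n d) \<subseteq>
      fun_vs.span (unit_vec ` {x. r x = d})"
    by (intro fun_vs.span_minimal) auto
  have "unit_vec x \<in> fun_vs.span ((\<lambda>S. phi r (bprod b S)) ` subsets_of_card n d)"
    if x: "r x = d" for x
  proof -
    obtain U where U: "U \<in> bases r x" using basis_exists[of x] by blast
    obtain xs where xs: "set xs = U" "distinct xs" using finite_distinct_list[OF finite] by blast
    have atoms: "U \<subseteq> atoms" "length xs = d"
      using U xs x distinct_card[of xs] by (auto simp: bases_def)
    have "unit_vec u \<in> fun_vs.span (b ` {1..n})" if "u \<in> U" for u
      unfolding b using that atoms(1) by (auto simp: vec_space_def unit_vec_def split: if_splits)
    then have "vprod (map unit_vec xs) \<in> fun_vs.span (bprod b ` subsets_of_card n d)"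
      using vprod_in_span_bprod[OF k, of "map unit_vec xs" b n] xs atoms(2) by auto
    then have "phi r (std U) \<in> fun_vs.span (phi r ` bprod b ` subsets_of_card n d)"
      unfolding vprod_unit_vec[OF xs(2)] xs(1) P.span_image by (rule imageI)
    moreover have "phi r (std U) = (unit_vec x :: 'a \<Rightarrow> 'k)"
    proof
      fix y
      have "U \<in> bases r y \<longleftrightarrow> y = x" using U bases_unique by blast
      then show "phi r (std U) y = (unit_vec x y :: 'k)" by (simp add: phi_std unit_vec_def)
    qed
    ultimately show ?thesis by (simp add: image_image)
  qed
  then show "fun_vs.span (unit_vec ` {x. r x = d}) \<subseteq>
      fun_vs.span ((\<lambda>S. phi r (bprod b S)) ` subsets_of_card n d)"
    by (intro fun_vs.span_minimal) auto
qed

text \<open>The greedy family and the unit vectors at the elements of rank \<open>d\<close> are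
  bases of the same space.\<close>

lemma (in geometric_lattice) card_shifting:
  fixes b :: "nat \<Rightarrow> 'a \<Rightarrow> 'k::field"
  assumes k: "CHAR('k) = 2" and b: "fun_vs.span (b ` {1..n}) = vec_space atoms"
  shows "card {S \<in> shifting r n b. card S = d} = card {x. r x = d}"
proof -
  let ?v = "\<lambda>S. phi r (bprod b S)" and ?J = "subsets_of_card n d"
  let ?G = "{S \<in> shifting r n b. card S = d}"
  have "finite ?J" by (simp add: subsets_of_card_def)
  moreover have "transp_on ?J lex_less"
    by (rule transp_onI) (metis lex_less_trans finite_in_subsets_of_card)
  moreover have "asymp_on ?J lex_less"
    by (rule asymp_onI) (metis lex_less_asym finite_in_subsets_of_card)
  moreover have "totalp_on ?J lex_less"
    by (rule totalp_onI) (metis lex_less_total finite_in_subsets_of_card)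
  moreover have "?G = {S \<in> ?J. ?v S \<notin> fun_vs.span (?v ` {T \<in> ?J. lex_less T S})}"
  proof -
    have "lex_below n S = {T \<in> ?J. lex_less T S}" if "card S = d" for S
      using that by (auto simp: lex_below_def subsets_of_card_def)
    then show ?thesis by (auto simp: shifting_def subsets_of_card_def)
  qed
  ultimately have "inj_on ?v ?G \<and> fun_vs.independent (?v ` ?G) \<and>
      fun_vs.span (?v ` ?G) = fun_vs.span (?v ` ?J)"
    by (rule greedy_basis)
  then have v: "inj_on ?v ?G" "fun_vs.independent (?v ` ?G)"
      "fun_vs.span (?v ` ?G) = fun_vs.span (?v ` ?J)" by auto
  have "card ?G = fun_vs.dim (?v ` ?J)"
    using fun_vs.dim_eq_card[OF v(3,2)] card_image[OF v(1)] by simp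
  also have "\<dots> = card (unit_vec ` {x. r x = d} :: ('a \<Rightarrow> 'k) set)"
    using span_phi_bprod[OF k b] by (intro fun_vs.dim_eq_card independent_unit_vec) simp
  also have "\<dots> = card {x. r x = d}"
    by (rule card_image) (rule inj_on_subset[OF inj_unit_vec], simp)
  finally show ?thesis .
qed

lemma (in geometric_lattice) f_complex_shifting:
  fixes b :: "nat \<Rightarrow> 'a \<Rightarrow> 'k::field"
  assumes "CHAR('k) = 2" "fun_vs.span (b ` {1..n}) = vec_space atoms"
  shows "f_complex (shifting r n b) = f_semilattice r"
proof
  fix i
  show "f_complex (shifting r n b) i = f_semilattice r i"
  proof (cases "i + 1 \<ge> 0")
    case True
    then obtain d where "i + 1 = int d" using nonneg_int_cases by blast
    then show ?thesis using card_shifting[OF assms, of d] by (simp add: f_complex_def f_semilattice_def)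
  next
    case False
    \<comment> \<open>For \<open>i\<close> below -1 both sides count the empty set.\<close>
    then have "int d \<noteq> i + 1" for d by linarith
    then show ?thesis by (simp add: f_complex_def f_semilattice_def)
  qed
qed

text \<open>The right-hand side does not mention \<open>ord\<close>, which settles independence of
  the order of the atoms.\<close>

lemma (in geometric_lattice) Delta_eq_shifting:
  fixes b :: "nat \<Rightarrow> 'a \<Rightarrow> 'k::field"
  assumes "CHAR('k) = 2" "linear_order_on atoms ord" "generic_basis atoms b"
  shows "Delta r ord b = shifting r (card (atoms :: 'a set)) b"
proof -
  have "b j \<in> vec_space atoms" if "j \<in> {1..card (atoms :: 'a set)}" for j
    using generic_basis_imp_vectors[OF assms(3)] that by (simp add: generic_vectors_def)
  then have "S \<in> Delta r ord b \<longleftrightarrow> S \<in> shifting r (card (atoms :: 'a set)) b" for S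
    using mem_Delta_iff[of ord b S, OF assms(1,2)] by (simp add: shifting_def lex_below_def)
  then show ?thesis by blast
qed

theorem theorem3p3:
  fixes r :: "'a::{finite,semilattice_inf,order_bot} \<Rightarrow> nat"
    and ord :: "'a rel"
    and b :: "nat \<Rightarrow> 'a \<Rightarrow> 'k::field"
  assumes "geometric_semilattice r"
    and "CHAR('k) = 2"
    and "linear_order_on atoms ord"
    and "generic_basis atoms b"
  shows "simplicial_complex_on {1..card (atoms :: 'a set)} (Delta r ord b)
    \<and> shifted (Delta r ord b)
    \<and> f_complex (Delta r ord b) = f_semilattice r
    \<and> (\<forall>(ord' :: 'a rel) (b' :: nat \<Rightarrow> 'a \<Rightarrow> 'l::field).
          CHAR('l) = 2 \<and> linear_order_on atoms ord' \<and> generic_basis atoms b' \<longrightarrow>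
          Delta r ord' b' = Delta r ord b)"
proof -
  interpret geometric_lattice r by standard (rule assms(1))
  let ?n = "card (atoms :: 'a set)"
  have gen: "generic_vectors atoms ?n b" by (rule generic_basis_imp_vectors[OF assms(4)])
  have span: "fun_vs.span (b ` {1..?n}) = vec_space atoms"
    using assms(4) by (simp add: generic_basis_def ordered_basis_def)
  \<comment> \<open>Order, basis and field change at once: the field \<open>'l\<close> may be a
    different type from \<open>'k\<close>.\<close>
  have "Delta r ord' b' = Delta r ord b"
    if "CHAR('l) = 2" "linear_order_on atoms ord'" "generic_basis atoms b'"
    for ord' :: "'a rel" and b' :: "nat \<Rightarrow> 'a \<Rightarrow> 'l"
    unfolding Delta_eq_shifting[OF that] Delta_eq_shifting[OF assms(2-4)]
    by (rule shifting_independent[OF that(1) assms(2) generic_basis_imp_vectors[OF that(3)] gen])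
  then show ?thesis
    unfolding Delta_eq_shifting[OF assms(2-4)]
    using simplicial_shifting[OF assms(2)] shifted_shifting[OF assms(2) gen]
      f_complex_shifting[OF assms(2) span] by auto
qed

end
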